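(* Let $U,V\subseteq\mathbb{R}^n$ be linear subspaces with $V\not\subset U$. For every $x_0\in\mathbb{R}^n$, put $\bar x_0:=P_{U\cap V}(x_0)$, $v_0:=P_V(x_0)$ and $v_{k+1}:=C_T(v_k)$ for $k\in\mathbb{N}$. Then $v_k\in V$ and $P_{U\cap V}(v_k)=\bar x_0$ for every $k\in\mathbb{N}$, and $$\|v_{k+1}-\bar x_0\|\le\rho_V\,\|v_k-\bar x_0\|,\qquad \rho_V=\frac{\sin^2\theta_p-\sin^2\theta_F}{\sin^2\theta_p+\sin^2\theta_F}.$$ The bound is sharp: there exists $x_0\in\mathbb{R}^n$ with $P_V(x_0)\notin U\cap V$ such that $$\|v_1-\bar x_0\|=\rho_V\,\|v_0-\bar x_0\|,$$ namely any $x_0$ with $P_V(x_0)=\bar x_0+\sin\theta_p\,f_{s+1}+\sin\theta_F\,f_p$, where $\{f_k\}$ is the principal-angle frame of $V$. In particular, $\rho_V\le c_F^2$, with strict inequality whenever $\theta_F<\pi/2$.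
   Context: $\mathbb{R}^n$ is Euclidean space. For a linear subspace $W$, $P_W$ is the orthogonal projection onto $W$ and $R_W=2P_W-\mathrm{Id}$. $U,V$ are linear subspaces with $V\not\subset U$; $p=\dim V$, $s=\dim(U\cap V)$, so $0\le s<p$. Principal angles: let $\sigma_1\ge\dots\ge\sigma_p\ge0$ be the singular values of $P_U|_V:V\to\mathbb{R}^n$ and $\theta_k=\arccos\sigma_k$, so $0\le\theta_1\le\dots\le\theta_p\le\pi/2$; the first $s$ of them are $0$. The Friedrichs angle is $\theta_F:=\theta_{s+1}\in(0,\pi/2]$, and $c_F:=\cos\theta_F$; $\theta_p$ is the largest principal angle. Principal-angle frame: an orthonormal basis $\{f_1,\dots,f_p\}$ of $V$ together with an orthonormal family $\{e_k\}_{k\in K}\subset U$, $K=\{k:\theta_k<\pi/2\}$, such that $P_Uf_k=\cos\theta_k\,e_k$ and $P_Ve_k=\cos\theta_k\,f_k$ for $k\in K$, and $P_Uf_k=0$ for $k\notin K$ (a singular value decomposition of $P_U|_V$). Circumcenter: for a finite set $S\subset\mathbb{R}^n$ for which some point $q\in\mathbb{R}^n$ is equidistant from all elements of $S$, $\mathrm{circumcenter}(S):=P_{\mathrm{aff}(S)}(q)$, the orthogonal projection of $q$ onto the affine hull of $S$ (independent of the choice of $q$). The circumcentered--reflection operator is $C_T(x):=\mathrm{circumcenter}\{x,R_Ux,R_VR_Ux\}$ (any point of $U\cap V$ is equidistant from the three vertices). *)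

theory Defs
  imports "HOL-Analysis.Analysis"
begin

section \<open>Orthogonal projections and reflections\<close>

text \<open>Intended for nonempty affine sets \<open>S\<close>, in particular for linear subspaces. The foot of the
  perpendicular is then unique (\<open>orth_proj_unique\<close>) and is the nearest point
  (\<open>orth_proj_eq_closest_point\<close>).\<close>

definition orth_proj :: "'a::euclidean_space set \<Rightarrow> 'a \<Rightarrow> 'a" where
  "orth_proj S x = (THE y. y \<in> S \<and> (\<forall>z\<in>S. orthogonal (x - y) (z - y)))"

definition reflection :: "'a::euclidean_space set \<Rightarrow> 'a \<Rightarrow> 'a" where
  "reflection W x = 2 *\<^sub>R orth_proj W x - x"

lemma foot_unique:
  fixes S :: "'a::euclidean_space set"
  assumes "y \<in> S" "\<forall>z\<in>S. orthogonal (x - y) (z - y)"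
    and "y' \<in> S" "\<forall>z\<in>S. orthogonal (x - y') (z - y')"
  shows "y = y'"
proof -
  have "(x - y) \<bullet> (y' - y) = 0" "(x - y') \<bullet> (y - y') = 0"
    using assms by (auto simp: orthogonal_def)
  then have "(y - y') \<bullet> (y - y') = 0"
    by (simp add: inner_diff_left inner_diff_right inner_commute)
  then show ?thesis by simp
qed

lemma orth_proj_unique:
  assumes "y \<in> S" "\<And>z. z \<in> S \<Longrightarrow> orthogonal (x - y) (z - y)"
  shows "orth_proj S x = y"
  unfolding orth_proj_def
proof (rule the_equality)
  show *: "y \<in> S \<and> (\<forall>z\<in>S. orthogonal (x - y) (z - y))" using assms by blast
  show "y' = y" if "y' \<in> S \<and> (\<forall>z\<in>S. orthogonal (x - y') (z - y'))" for y'
    using foot_unique[of y' S x y] that * by blast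
qed

lemma closest_point_orthogonal:
  fixes S :: "'a::euclidean_space set"
  assumes "affine S" "z \<in> S"
  shows "orthogonal (x - closest_point S x) (z - closest_point S x)"
proof -
  let ?p = "closest_point S x"
  have cl: "closed S" using assms(1) by (rule affine_closed)
  have cv: "convex S" using assms(1) by (rule affine_imp_convex)
  have "S \<noteq> {}" using assms(2) by blast
  with cl have p: "?p \<in> S" by (rule closest_point_in_set)
  have "2 *\<^sub>R ?p + (-1) *\<^sub>R z \<in> S"
    using assms(1) p assms(2) by (rule mem_affine) simp
  from closest_point_dot[OF cv cl this, of x] closest_point_dot[OF cv cl assms(2), of x]
  show ?thesis
    by (simp add: orthogonal_def inner_diff_right inner_add_right)
qed

lemma orth_proj_eq_closest_point:
  assumes "affine S" "S \<noteq> {}"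
  shows "orth_proj S x = closest_point S x"
  using closest_point_in_set[OF affine_closed[OF assms(1)] assms(2)]
    closest_point_orthogonal[OF assms(1)]
  by (rule orth_proj_unique)

lemma orth_proj_in:
  assumes "affine S" "S \<noteq> {}"
  shows "orth_proj S x \<in> S"
  unfolding orth_proj_eq_closest_point[OF assms]
  using affine_closed[OF assms(1)] assms(2) by (rule closest_point_in_set)

lemma orth_proj_orthogonal:
  assumes "affine S" "z \<in> S"
  shows "orthogonal (x - orth_proj S x) (z - orth_proj S x)"
proof -
  have "S \<noteq> {}" using assms(2) by blast
  then show ?thesis
    unfolding orth_proj_eq_closest_point[OF assms(1) \<open>S \<noteq> {}\<close>]
    by (intro closest_point_orthogonal assms)
qed

lemma orth_proj_subspace:
  assumes "subspace W"
  shows "orth_proj W x \<in> W" and "w \<in> W \<Longrightarrow> orthogonal (x - orth_proj W x) w"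
proof -
  have a: "affine W" "W \<noteq> {}"
    using assms by (auto simp: subspace_imp_affine subspace_def)
  show p: "orth_proj W x \<in> W" using a by (rule orth_proj_in)
  show "orthogonal (x - orth_proj W x) w" if "w \<in> W"
    using orth_proj_orthogonal[OF a(1), of "w + orth_proj W x" x] that p assms
    by (simp add: subspace_add)
qed

lemma orth_proj_subspace_unique:
  assumes "subspace W" "y \<in> W" "\<And>w. w \<in> W \<Longrightarrow> orthogonal (x - y) w"
  shows "orth_proj W x = y"
proof (rule orth_proj_unique)
  show "y \<in> W" by (rule assms(2))
  show "orthogonal (x - y) (z - y)" if "z \<in> W" for z
    using subspace_diff[OF assms(1) that assms(2)] by (rule assms(3))
qed

lemma linear_orth_proj:
  assumes "subspace W"
  shows "linear (orth_proj W)"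
proof (rule linearI)
  note o = orth_proj_subspace[OF assms]
  show "orth_proj W (x + y) = orth_proj W x + orth_proj W y" for x y
  proof (rule orth_proj_subspace_unique[OF assms])
    show "orth_proj W x + orth_proj W y \<in> W" using assms o by (simp add: subspace_add)
    show "orthogonal (x + y - (orth_proj W x + orth_proj W y)) w" if "w \<in> W" for w
      using o(2)[OF that, of x] o(2)[OF that, of y]
      by (simp add: orthogonal_def inner_diff_left inner_add_left)
  qed
  show "orth_proj W (c *\<^sub>R x) = c *\<^sub>R orth_proj W x" for c x
  proof (rule orth_proj_subspace_unique[OF assms])
    show "c *\<^sub>R orth_proj W x \<in> W" using assms o by (simp add: subspace_scale)
    show "orthogonal (c *\<^sub>R x - c *\<^sub>R orth_proj W x) w" if "w \<in> W" for w
      using o(2)[OF that, of x]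
      by (simp add: orthogonal_def inner_diff_left)
  qed
qed


section \<open>Singular values of the restriction of a linear map to a subspace\<close>

text \<open>For linear \<open>A\<close>, the map \<open>adjoint_on V A\<close> is the adjoint of the restriction of \<open>A\<close> to the
  inner product space \<open>V\<close>, see \<open>adjoint_on_works\<close>.\<close>

definition adjoint_on ::
  "'a::euclidean_space set \<Rightarrow> ('a \<Rightarrow> 'b::euclidean_space) \<Rightarrow> 'b \<Rightarrow> 'a" where
  "adjoint_on V A = orth_proj V \<circ> adjoint A"

lemma adjoint_on_works:
  fixes A :: "'a::euclidean_space \<Rightarrow> 'b::euclidean_space"
  assumes "subspace V" "linear A" "x \<in> V"
  shows "adjoint_on V A y \<in> V" and "x \<bullet> adjoint_on V A y = A x \<bullet> y"
proof -
  show "adjoint_on V A y \<in> V"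
    by (simp add: adjoint_on_def orth_proj_subspace(1)[OF assms(1)])
  have "(adjoint A y - adjoint_on V A y) \<bullet> x = 0"
    using orth_proj_subspace(2)[OF assms(1,3)] by (simp add: adjoint_on_def orthogonal_def)
  then have "x \<bullet> adjoint_on V A y = x \<bullet> adjoint A y"
    by (simp add: inner_diff_left inner_commute[of x])
  also have "\<dots> = A x \<bullet> y" by (rule adjoint_works[OF assms(2)])
  finally show "x \<bullet> adjoint_on V A y = A x \<bullet> y" .
qed

text \<open>The eigenspace, for the eigenvalue \<open>\<sigma>\<^sup>2\<close>, of the self-adjoint operator
  \<open>(A|\<^sub>V)\<^sup>* (A|\<^sub>V)\<close> on \<open>V\<close>.\<close>

definition singular_space ::
  "'a::euclidean_space set \<Rightarrow> ('a \<Rightarrow> 'b::euclidean_space) \<Rightarrow> real \<Rightarrow> 'a set" where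
  "singular_space V A \<sigma> = {x \<in> V. adjoint_on V A (A x) = \<sigma>\<^sup>2 *\<^sub>R x}"

text \<open>The singular values in nonincreasing order, each repeated according to its multiplicity.\<close>

definition singular_values ::
  "'a::euclidean_space set \<Rightarrow> ('a \<Rightarrow> 'b::euclidean_space) \<Rightarrow> real list" where
  "singular_values V A =
     concat (map (\<lambda>\<sigma>. replicate (dim (singular_space V A \<sigma>)) \<sigma>)
       (rev (sorted_list_of_set {\<sigma>. 0 \<le> \<sigma> \<and> singular_space V A \<sigma> \<noteq> {0}})))"


section \<open>Principal angles and principal-angle frames\<close>

text \<open>The index \<open>k\<close> ranges over \<open>1, \<dots>, dim V\<close>.\<close>

definition principal_angle :: "'a::euclidean_space set \<Rightarrow> 'a set \<Rightarrow> nat \<Rightarrow> real" where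
  "principal_angle U V k = arccos (singular_values V (orth_proj U) ! (k - 1))"

definition friedrichs_angle :: "'a::euclidean_space set \<Rightarrow> 'a set \<Rightarrow> real" where
  "friedrichs_angle U V = principal_angle U V (dim (U \<inter> V) + 1)"

definition largest_angle :: "'a::euclidean_space set \<Rightarrow> 'a set \<Rightarrow> real" where
  "largest_angle U V = principal_angle U V (dim V)"

definition orthonormal_family :: "nat set \<Rightarrow> (nat \<Rightarrow> 'a::euclidean_space) \<Rightarrow> bool" where
  "orthonormal_family I b \<longleftrightarrow> (\<forall>j\<in>I. \<forall>k\<in>I. b j \<bullet> b k = (if j = k then 1 else 0))"

text \<open>Only the values \<open>f k\<close> with \<open>1 \<le> k \<le> dim V\<close> and \<open>e k\<close> with \<open>k \<in> K\<close> are constrained.\<close>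

definition principal_frame ::
  "'a::euclidean_space set \<Rightarrow> 'a set \<Rightarrow> (nat \<Rightarrow> 'a) \<Rightarrow> (nat \<Rightarrow> 'a) \<Rightarrow> bool" where
  "principal_frame U V f e \<longleftrightarrow>
     (let K = {k \<in> {1..dim V}. principal_angle U V k < pi / 2} in
       orthonormal_family {1..dim V} f \<and> span (f ` {1..dim V}) = V \<and>
       orthonormal_family K e \<and> e ` K \<subseteq> U \<and>
       (\<forall>k\<in>K. orth_proj U (f k) = cos (principal_angle U V k) *\<^sub>R e k \<and>
              orth_proj V (e k) = cos (principal_angle U V k) *\<^sub>R f k) \<and>
       (\<forall>k\<in>{1..dim V} - K. orth_proj U (f k) = 0))"


section \<open>The circumcentered-reflection operator\<close>

text \<open>Meaningful when some point is equidistant from all elements of \<open>S\<close>; the result does not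
  depend on the chosen point (\<open>circumcenter_eq\<close>).\<close>

definition equidistant :: "'a::euclidean_space set \<Rightarrow> 'a \<Rightarrow> bool" where
  "equidistant S q \<longleftrightarrow> (\<forall>a\<in>S. \<forall>b\<in>S. dist q a = dist q b)"

definition circumcenter :: "'a::euclidean_space set \<Rightarrow> 'a" where
  "circumcenter S = orth_proj (affine hull S) (SOME q. equidistant S q)"

lemma circumcenter_eq:
  assumes "equidistant S q" "S \<noteq> {}"
  shows "circumcenter S = orth_proj (affine hull S) q"
proof -
  define r where "r = (SOME q. equidistant S q)"
  have r: "equidistant S r" unfolding r_def using assms(1) by (rule someI)
  obtain a where a: "a \<in> S" using assms(2) by blast
  have sq: "(q - r) \<bullet> (b - a) = 0" if b: "b \<in> S" for b
  proof -
    have "dist q a = dist q b" "dist r a = dist r b"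
      using a b assms(1) r unfolding equidistant_def by blast+
    then have "(dist q a)\<^sup>2 = (dist q b)\<^sup>2" "(dist r a)\<^sup>2 = (dist r b)\<^sup>2"
      by simp_all
    then show ?thesis
      by (simp add: dist_norm power2_norm_eq_inner inner_diff_left inner_diff_right inner_commute)
  qed
  have "affine hull S \<subseteq> {z. (q - r) \<bullet> z = (q - r) \<bullet> a}"
    using sq by (intro hull_minimal) (auto simp: inner_diff_right affine_hyperplane)
  then have hull: "(q - r) \<bullet> z = (q - r) \<bullet> a" if "z \<in> affine hull S" for z
    using that by blast
  let ?p = "orth_proj (affine hull S) q"
  have ne: "affine hull S \<noteq> {}" using assms(2) by simp
  have p: "?p \<in> affine hull S" using ne by (intro orth_proj_in) auto
  have "orth_proj (affine hull S) r = ?p"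
  proof (rule orth_proj_unique[OF p])
    fix z assume z: "z \<in> affine hull S"
    have "(q - ?p) \<bullet> (z - ?p) = 0"
      using orth_proj_orthogonal[OF _ z, of q] by (simp add: orthogonal_def)
    then show "orthogonal (r - ?p) (z - ?p)"
      using hull[OF z] hull[OF p] by (simp add: orthogonal_def inner_diff_left inner_diff_right)
  qed
  then show ?thesis by (simp add: circumcenter_def r_def)
qed

definition crm_op :: "'a::euclidean_space set \<Rightarrow> 'a set \<Rightarrow> 'a \<Rightarrow> 'a" where
  "crm_op U V x = circumcenter {x, reflection U x, reflection V (reflection U x)}"

primrec crm_seq :: "'a::euclidean_space set \<Rightarrow> 'a set \<Rightarrow> 'a \<Rightarrow> nat \<Rightarrow> 'a" where
  "crm_seq U V x0 0 = orth_proj V x0"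
| "crm_seq U V x0 (Suc k) = crm_op U V (crm_seq U V x0 k)"

definition crm_rate :: "'a::euclidean_space set \<Rightarrow> 'a set \<Rightarrow> real" where
  "crm_rate U V =
     ((sin (largest_angle U V))\<^sup>2 - (sin (friedrichs_angle U V))\<^sup>2) /
     ((sin (largest_angle U V))\<^sup>2 + (sin (friedrichs_angle U V))\<^sup>2)"

end

theory Submission
  imports Defs
begin

text \<open>
  Restricted to \<open>V\<close>, one step of the circumcentered-reflection operator is an exact line search.
  Let \<open>B = Id - P\<^sub>V P\<^sub>U\<close> on \<open>V\<close>. The three vertices \<open>v\<close>, \<open>R\<^sub>U v\<close> and \<open>R\<^sub>V R\<^sub>U v\<close> have equal norms, so the
  circumcenter is the point of smallest norm in their affine hull, and for \<open>v \<in> V\<close> that point lies on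
  the line through \<open>v\<close> in direction \<open>B v\<close>:
  \<open>C\<^sub>T v = v - ((v \<bullet> B v) / (B v \<bullet> B v)) B v\<close> (\<open>crm_op_eq_line_min\<close>). The same formula
  holds for \<open>v - z\<close> with \<open>z = P\<^sub>U\<^sub>\<inter>\<^sub>V v\<close>, as \<open>z\<close> is in the kernel of \<open>B\<close>
  (\<open>crm_op_residual\<close>); since \<open>B\<close> maps into the orthogonal complement of
  \<open>U \<inter> V\<close>, the projection \<open>z\<close> does not change along the iteration.

  For \<open>w = v - z\<close> the squared norm drops from \<open>w \<bullet> w\<close> to
  \<open>w \<bullet> w - (w \<bullet> B w)\<^sup>2 / (B w \<bullet> B w)\<close>. The operator \<open>B\<close> is symmetric; it is diagonal in a
  principal-angle frame, with eigenvalues \<open>sin\<^sup>2 \<theta>\<^sub>k\<close> (\<open>defect_principal_vector\<close>), and on the orthogonal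
  complement of \<open>U \<inter> V\<close> these lie between \<open>m = sin\<^sup>2 \<theta>\<^sub>F > 0\<close> and \<open>M = sin\<^sup>2 \<theta>\<^sub>p\<close>. Kantorovich's
  inequality \<open>4 m M (w \<bullet> w) (B w \<bullet> B w) \<le> (M + m)\<^sup>2 (w \<bullet> B w)\<^sup>2\<close> therefore bounds the ratio of the norms by
  \<open>(M - m) / (M + m)\<close> (\<open>kantorovich_line_min\<close>), and equality holds for \<open>w = \<surd>M f\<^sub>s\<^sub>+\<^sub>1 + \<surd>m f\<^sub>p\<close>
  (\<open>kantorovich_line_min_sharp\<close>). The comparison with \<open>cos\<^sup>2 \<theta>\<^sub>F = 1 - m\<close> is elementary.

  This uses that a frame exists and that the principal angles, which are given by a sorted
  list of singular values, have the expected meaning: they increase, lie in \<open>[0, \<pi>/2]\<close>, and vanish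
  exactly for the first \<open>dim (U \<inter> V)\<close> indices (\<open>principal_angle_eq_0_iff\<close>). Both facts come from an
  orthonormal eigenbasis of the Gram operator, which the spectral theorem on a subspace provides
  (\<open>symmetric_eigenbasis\<close>).
\<close>


section \<open>The spectral theorem on a subspace\<close>

text \<open>The form \<open>q y = l (y \<bullet> y) - A y \<bullet> y\<close>, with \<open>l\<close> the maximum of the Rayleigh quotient, is
  nonnegative on \<open>V\<close> and vanishes at the maximiser \<open>x\<close>. Moving from \<open>x\<close> by \<open>t\<close> times the residual
  \<open>r = l x - A x\<close> changes \<open>q\<close> to first order by \<open>2 t (r \<bullet> r)\<close>, so a nonzero residual would make
  \<open>q\<close> negative for a small negative \<open>t\<close>.\<close>

lemma symmetric_max_eigenvector:
  fixes V :: "'a::euclidean_space set"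
  assumes V: "subspace V" and A: "linear A" and inv: "\<And>x. x \<in> V \<Longrightarrow> A x \<in> V"
    and sym: "\<And>x y. x \<in> V \<Longrightarrow> y \<in> V \<Longrightarrow> A x \<bullet> y = x \<bullet> A y"
    and x: "x \<in> V" "norm x = 1"
    and max: "\<And>y. y \<in> V \<Longrightarrow> norm y = 1 \<Longrightarrow> A y \<bullet> y \<le> A x \<bullet> x"
  shows "A x = (A x \<bullet> x) *\<^sub>R x"
proof -
  define l where "l = A x \<bullet> x"
  define r where "r = l *\<^sub>R x - A x"
  define a where "a = r \<bullet> r"
  define Q where "Q = l * (r \<bullet> r) - A r \<bullet> r"
  have xx: "x \<bullet> x = 1" using x(2) by (simp add: norm_eq_1)
  have rV: "r \<in> V" unfolding r_def by (intro subspace_diff[OF V] subspace_scale[OF V] x inv)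
  have form: "0 \<le> l * (y \<bullet> y) - A y \<bullet> y" if y: "y \<in> V" for y
  proof (cases "y = 0")
    case False
    define z where "z = (1 / norm y) *\<^sub>R y"
    have "A z \<bullet> z \<le> l"
      unfolding l_def using False by (intro max) (auto simp: z_def y subspace_scale[OF V])
    moreover have "A z \<bullet> z = (A y \<bullet> y) / (y \<bullet> y)"
      using False by (simp add: z_def linear_cmul[OF A] power2_eq_square flip: power2_norm_eq_inner)
    ultimately show ?thesis using False by (simp add: divide_le_eq)
  qed (simp add: linear_0[OF A])
  have ineq: "0 \<le> 2 * t * a + t\<^sup>2 * Q" for t
  proof -
    have "x + t *\<^sub>R r \<in> V" by (intro subspace_add[OF V] subspace_scale[OF V] x rV)
    moreover have "l * ((x + t *\<^sub>R r) \<bullet> (x + t *\<^sub>R r)) - A (x + t *\<^sub>R r) \<bullet> (x + t *\<^sub>R r)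
        = 2 * t * a + t\<^sup>2 * Q"
    proof -
      have "A x \<bullet> r = l * (x \<bullet> r) - a" by (simp add: a_def r_def inner_diff_left)
      moreover from this have "A r \<bullet> x = l * (x \<bullet> r) - a"
        using sym[OF rV x(1)] by (simp add: inner_commute)
      ultimately show ?thesis
        by (simp add: linear_add[OF A] linear_cmul[OF A] inner_add_left inner_add_right
            inner_commute[of r x] xx Q_def flip: l_def)
          (simp add: algebra_simps power2_eq_square)
    qed
    ultimately show ?thesis using form by metis
  qed
  have Q: "0 \<le> Q" unfolding Q_def by (rule form[OF rV])
  \<comment> \<open>The minimiser \<open>- a / Q\<close> of the quadratic would do, but \<open>Q\<close> may be \<open>0\<close>.\<close>
  have "2 * (- a / (Q + 1)) * a + (- a / (Q + 1))\<^sup>2 * Q = - (a\<^sup>2 * (Q + 2)) / (Q + 1)\<^sup>2"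
    using Q by (simp add: divide_simps) (simp add: algebra_simps power2_eq_square)
  with ineq[of "- a / (Q + 1)"] have "0 \<le> - (a\<^sup>2 * (Q + 2)) / (Q + 1)\<^sup>2" by metis
  moreover have "0 < (Q + 1)\<^sup>2" using Q by simp
  ultimately have "a\<^sup>2 * (Q + 2) \<le> 0" by (metis neg_0_le_iff_le not_less zero_le_divide_iff)
  then have "a = 0" using Q by (simp add: mult_le_0_iff)
  then show ?thesis by (simp add: a_def r_def l_def)
qed

lemma symmetric_eigenvector_exists:
  fixes V :: "'a::euclidean_space set"
  assumes V: "subspace V" and A: "linear A" and inv: "\<And>x. x \<in> V \<Longrightarrow> A x \<in> V"
    and sym: "\<And>x y. x \<in> V \<Longrightarrow> y \<in> V \<Longrightarrow> A x \<bullet> y = x \<bullet> A y"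
    and nontriv: "V \<noteq> {0}"
  obtains x where "x \<in> V" "norm x = 1" "A x = (A x \<bullet> x) *\<^sub>R x"
proof -
  let ?S = "V \<inter> sphere 0 1"
  obtain w where w: "w \<in> V" "w \<noteq> 0" using nontriv subspace_0[OF V] by blast
  have "(1 / norm w) *\<^sub>R w \<in> ?S" using w by (simp add: subspace_scale[OF V])
  moreover have "compact ?S" using closed_subspace[OF V] by (simp add: closed_Int_compact)
  moreover have "continuous_on ?S (\<lambda>y. A y \<bullet> y)"
    by (intro continuous_intros linear_continuous_on linear_conv_bounded_linear[THEN iffD1] A)
  ultimately obtain x where x: "x \<in> ?S" and max: "\<And>y. y \<in> ?S \<Longrightarrow> A y \<bullet> y \<le> A x \<bullet> x"
    using continuous_attains_sup[of ?S "\<lambda>y. A y \<bullet> y"] by blast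
  show thesis
  proof (rule that)
    show "A x = (A x \<bullet> x) *\<^sub>R x"
      by (rule symmetric_max_eigenvector[OF V A inv sym]) (use x max in auto)
  qed (use x in auto)
qed

text \<open>A unit eigenvector splits off: by symmetry its orthogonal complement in \<open>V\<close> is again invariant,
  and it has smaller dimension.\<close>

lemma symmetric_eigenbasis:
  fixes V :: "'a::euclidean_space set"
  assumes "subspace V" and "linear A" and "\<And>x. x \<in> V \<Longrightarrow> A x \<in> V"
    and "\<And>x y. x \<in> V \<Longrightarrow> y \<in> V \<Longrightarrow> A x \<bullet> y = x \<bullet> A y"
  obtains B where "pairwise orthogonal B" "\<And>b. b \<in> B \<Longrightarrow> norm b = 1" "span B = V"
    "\<And>b. b \<in> B \<Longrightarrow> A b = (A b \<bullet> b) *\<^sub>R b"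
  using assms
proof (induction "dim V" arbitrary: V thesis rule: less_induct)
  case (less V)
  note V = less.prems(2) and A = less.prems(3) and inv = less.prems(4) and sym = less.prems(5)
  show ?case
  proof (cases "V = {0}")
    case True
    then show ?thesis using less.prems(1)[of "{}"] by simp
  next
    case False
    then obtain x where x: "x \<in> V" "norm x = 1" "A x = (A x \<bullet> x) *\<^sub>R x"
      using symmetric_eigenvector_exists[OF V A inv sym] by blast
    have xx: "x \<bullet> x = 1" using x(2) by (simp add: norm_eq_1)
    define W where "W = {y \<in> V. y \<bullet> x = 0}"
    have W: "subspace W"
      using V unfolding W_def subspace_def by (simp add: inner_add_left)
    have WV: "W \<subseteq> V" "x \<notin> W" using xx by (auto simp: W_def)
    then have "dim W < dim V"
      using subspace_dim_equal[OF W V] x(1) by (metis not_le)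
    moreover have "A y \<in> W" if "y \<in> W" for y
    proof -
      have y: "y \<in> V" "y \<bullet> x = 0" using that by (auto simp: W_def)
      have "A y \<bullet> x = (A x \<bullet> x) * (y \<bullet> x)" using sym[OF y(1) x(1)] x(3) by (metis inner_scaleR_right)
      then show ?thesis using inv y by (simp add: W_def)
    qed
    moreover have "A y \<bullet> z = y \<bullet> A z" if "y \<in> W" "z \<in> W" for y z
      using sym that WV(1) by blast
    ultimately obtain B where B: "pairwise orthogonal B" "\<And>b. b \<in> B \<Longrightarrow> norm b = 1" "span B = W"
      "\<And>b. b \<in> B \<Longrightarrow> A b = (A b \<bullet> b) *\<^sub>R b"
      using less.hyps[of W] W A by metis
    have BW: "B \<subseteq> W" using B(3) span_superset by blast
    show ?thesis
    proof (rule less.prems(1)[of "insert x B"])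
      show "pairwise orthogonal (insert x B)"
        using B(1) BW by (auto simp: W_def pairwise_insert orthogonal_def inner_commute)
      show "span (insert x B) = V"
      proof
        show "span (insert x B) \<subseteq> V" using x(1) BW WV(1) V by (intro span_minimal) auto
        show "V \<subseteq> span (insert x B)"
        proof
          fix v assume v: "v \<in> V"
          have "v - (v \<bullet> x) *\<^sub>R x \<in> W"
            using v x(1) xx V by (simp add: W_def subspace_diff subspace_scale inner_diff_left)
          then show "v \<in> span (insert x B)" using B(3) span_breakdown_eq by blast
        qed
      qed
    qed (use B x in auto)
  qed
qed

text \<open>A symmetric map forces an eigenvector to be orthogonal to all basis vectors with another
  eigenvalue, so only those with its own eigenvalue occur in its expansion.\<close>

lemma eigenspace_eq_span_eigenbasis:
  fixes V :: "'a::euclidean_space set"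
  assumes A: "linear A"
    and sym: "\<And>x y. x \<in> V \<Longrightarrow> y \<in> V \<Longrightarrow> A x \<bullet> y = x \<bullet> A y"
    and B: "pairwise orthogonal B" "\<And>b. b \<in> B \<Longrightarrow> norm b = 1" "span B = V"
    and ev: "\<And>b. b \<in> B \<Longrightarrow> A b = ev b *\<^sub>R b"
  shows "{x \<in> V. A x = l *\<^sub>R x} = span {b \<in> B. ev b = l}"
proof
  have BV: "B \<subseteq> V" using B(3) span_superset by blast
  show "span {b \<in> B. ev b = l} \<subseteq> {x \<in> V. A x = l *\<^sub>R x}"
  proof (rule span_minimal)
    show "{b \<in> B. ev b = l} \<subseteq> {x \<in> V. A x = l *\<^sub>R x}" using BV ev by auto
    show "subspace {x \<in> V. A x = l *\<^sub>R x}"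
      using subspace_span[of B] unfolding subspace_def B(3)
      by (auto simp: linear_0[OF A] linear_add[OF A] linear_cmul[OF A] scaleR_add_right)
  qed
  show "{x \<in> V. A x = l *\<^sub>R x} \<subseteq> span {b \<in> B. ev b = l}"
  proof safe
    fix x assume x: "x \<in> V" "A x = l *\<^sub>R x"
    have fin: "finite B" using B(1) by (rule pairwise_orthogonal_imp_finite)
    have zero: "x \<bullet> b = 0" if b: "b \<in> B" "ev b \<noteq> l" for b
    proof -
      have "A x \<bullet> b = x \<bullet> A b" using sym x(1) b(1) BV by blast
      then have "(l - ev b) * (x \<bullet> b) = 0" using x(2) ev[OF b(1)] by (simp add: algebra_simps)
      then show ?thesis using b(2) by simp
    qed
    have "x = (\<Sum>b\<in>B. (x \<bullet> b) *\<^sub>R b)"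
      using orthonormal_basis_expand[OF B(1,2) _ fin, of x] x(1) B(3) by simp
    also have "\<dots> \<in> span {b \<in> B. ev b = l}"
    proof (rule span_sum)
      fix b assume b: "b \<in> B"
      then show "(x \<bullet> b) *\<^sub>R b \<in> span {b \<in> B. ev b = l}"
        using zero[OF b] by (cases "ev b = l") (auto intro: span_scale span_base span_zero)
    qed
    finally show "x \<in> span {b \<in> B. ev b = l}" .
  qed
qed

lemma dim_span_orthonormal:
  assumes "pairwise orthogonal B" "\<And>b. b \<in> B \<Longrightarrow> norm b = 1"
  shows "dim (span B) = card B"
proof -
  have "independent B" using assms by (intro pairwise_orthogonal_independent) force+
  then show ?thesis by (simp add: dim_eq_card_independent)
qed


section \<open>Singular values\<close>

text \<open>This turns the concatenation of blocks in the definition of the singular values into the list of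
  values of a function along a list of basis vectors.\<close>

lemma map_concat_fibres:
  assumes "\<And>s. s \<in> set ss \<Longrightarrow> \<forall>b\<in>set (F s). h b = s"
  shows "map h (concat (map F ss)) = concat (map (\<lambda>s. replicate (length (F s)) s) ss)"
  using assms by (induction ss) (auto simp flip: map_replicate_const)

lemma sorted_wrt_concat_replicate:
  assumes "sorted_wrt (\<ge>) (ss :: real list)"
  shows "sorted_wrt (\<ge>) (concat (map (\<lambda>s. replicate (n s) s) ss))"
proof -
  have rep: "sorted_wrt (\<ge>) (replicate k (s :: real))" for k s by (induction k) auto
  show ?thesis using assms by (induction ss) (auto simp: sorted_wrt_append rep)
qed

lemma singular_values_decreasing: "sorted_wrt (\<ge>) (singular_values V A)"
proof -
  have "sorted_wrt (\<ge>) (rev (sorted_list_of_set S))" for S :: "real set"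
    using sorted_sorted_list_of_set[of S] by (simp add: sorted_wrt_rev)
  then show ?thesis unfolding singular_values_def by (rule sorted_wrt_concat_replicate)
qed

lemma linear_gram:
  fixes A :: "'a::euclidean_space \<Rightarrow> 'b::euclidean_space"
  assumes "subspace V" "linear A"
  shows "linear (\<lambda>x. adjoint_on V A (A x))"
  unfolding adjoint_on_def o_def
  using linear_compose[OF linear_compose[OF assms(2) adjoint_linear[OF assms(2)]]
      linear_orth_proj[OF assms(1)]]
  by (simp add: o_def)

lemma gram_inner:
  fixes A :: "'a::euclidean_space \<Rightarrow> 'b::euclidean_space"
  assumes "subspace V" "linear A" "y \<in> V"
  shows "adjoint_on V A (A x) \<bullet> y = A x \<bullet> A y"
  using adjoint_on_works(2)[OF assms, of "A x"] by (simp add: inner_commute)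

lemma gram_symmetric:
  fixes A :: "'a::euclidean_space \<Rightarrow> 'b::euclidean_space"
  assumes "subspace V" "linear A" "x \<in> V" "y \<in> V"
  shows "adjoint_on V A (A x) \<bullet> y = x \<bullet> adjoint_on V A (A y)"
  using gram_inner[OF assms(1,2,4), of x] gram_inner[OF assms(1,2,3), of y]
  by (simp add: inner_commute)

text \<open>The right singular vectors. The singular value of \<open>b\<close> need not be mentioned separately: the
  eigenvalue of the Gram operator at a unit vector \<open>b\<close> is \<open>A b \<bullet> A b\<close>.\<close>

definition singular_basis ::
  "'a::euclidean_space set \<Rightarrow> ('a \<Rightarrow> 'b::euclidean_space) \<Rightarrow> 'a set \<Rightarrow> bool" where
  "singular_basis V A B \<longleftrightarrow> pairwise orthogonal B \<and> (\<forall>b\<in>B. norm b = 1) \<and> span B = V \<and>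
     (\<forall>b\<in>B. adjoint_on V A (A b) = (norm (A b))\<^sup>2 *\<^sub>R b)"

lemma singular_basis_exists:
  fixes A :: "'a::euclidean_space \<Rightarrow> 'b::euclidean_space"
  assumes V: "subspace V" and A: "linear A"
  shows "\<exists>B. singular_basis V A B"
proof -
  have TV: "adjoint_on V A (A x) \<in> V" for x
    using adjoint_on_works(1)[OF V A subspace_0[OF V]] .
  obtain B where B: "pairwise orthogonal B" "\<And>b. b \<in> B \<Longrightarrow> norm b = 1" "span B = V"
    "\<And>b. b \<in> B \<Longrightarrow> adjoint_on V A (A b) = (adjoint_on V A (A b) \<bullet> b) *\<^sub>R b"
    using symmetric_eigenbasis[OF V linear_gram[OF V A] TV gram_symmetric[OF V A]] by metis
  have "adjoint_on V A (A b) = (norm (A b))\<^sup>2 *\<^sub>R b" if "b \<in> B" for b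
  proof -
    have "b \<in> V" using that B(3) span_base by blast
    then show ?thesis
      using B(4)[OF that] gram_inner[OF V A, of b b] by (simp add: power2_norm_eq_inner)
  qed
  then show ?thesis using B(1-3) unfolding singular_basis_def by blast
qed

lemma singular_space_eq_span:
  fixes A :: "'a::euclidean_space \<Rightarrow> 'b::euclidean_space"
  assumes V: "subspace V" and A: "linear A" and B: "singular_basis V A B" and s: "0 \<le> s"
  shows "singular_space V A s = span {b \<in> B. norm (A b) = s}"
    and "dim (singular_space V A s) = card {b \<in> B. norm (A b) = s}"
proof -
  have o: "pairwise orthogonal B" "\<And>b. b \<in> B \<Longrightarrow> norm b = 1" "span B = V"
    "\<And>b. b \<in> B \<Longrightarrow> adjoint_on V A (A b) = (norm (A b))\<^sup>2 *\<^sub>R b"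
    using B unfolding singular_basis_def by blast+
  have "{b \<in> B. (norm (A b))\<^sup>2 = s\<^sup>2} = {b \<in> B. norm (A b) = s}"
    using s by auto
  then show *: "singular_space V A s = span {b \<in> B. norm (A b) = s}"
    unfolding singular_space_def
    using eigenspace_eq_span_eigenbasis[OF linear_gram[OF V A] gram_symmetric[OF V A] o, of "s\<^sup>2"]
    by simp
  show "dim (singular_space V A s) = card {b \<in> B. norm (A b) = s}"
    unfolding * using o(1,2) by (intro dim_span_orthonormal) (auto intro: pairwise_mono)
qed

text \<open>Singular values are specified through dimensions of eigenspaces. Listing a singular basis
  fibre by fibre over the decreasingly sorted singular values lets the \<open>i\<close>-th singular value be
  read off as the norm of the image of the \<open>i\<close>-th basis vector.\<close>

lemma singular_basis_enumeration:
  fixes A :: "'a::euclidean_space \<Rightarrow> 'b::euclidean_space"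
  assumes V: "subspace V" and A: "linear A"
  obtains fs where "distinct fs" "singular_basis V A (set fs)"
    "singular_values V A = map (\<lambda>b. norm (A b)) fs"
proof -
  obtain B where B: "singular_basis V A B" using singular_basis_exists[OF V A] by blast
  have unit: "norm b = 1" if "b \<in> B" for b using B that by (simp add: singular_basis_def)
  have fin: "finite B" using B pairwise_orthogonal_imp_finite by (auto simp: singular_basis_def)
  note space = singular_space_eq_span(1)[OF V A B]
  define S where "S = {s. 0 \<le> s \<and> singular_space V A s \<noteq> {0}}"
  have S: "S = (\<lambda>b. norm (A b)) ` B"
  proof
    show "S \<subseteq> (\<lambda>b. norm (A b)) ` B"
    proof
      fix s assume "s \<in> S"
      then have "span {b \<in> B. norm (A b) = s} \<noteq> {0}" unfolding S_def using space by auto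
      then have "{b \<in> B. norm (A b) = s} \<noteq> {}" by (metis span_empty)
      then show "s \<in> (\<lambda>b. norm (A b)) ` B" by blast
    qed
    show "(\<lambda>b. norm (A b)) ` B \<subseteq> S"
    proof
      fix s assume "s \<in> (\<lambda>b. norm (A b)) ` B"
      then obtain b where b: "b \<in> B" "s = norm (A b)" by blast
      then have "b \<in> span {b \<in> B. norm (A b) = s}" "b \<noteq> 0"
        using unit[OF b(1)] by (auto intro: span_base)
      then show "s \<in> S" unfolding S_def using b space[of s] by auto
    qed
  qed
  have finS: "finite S" using fin S by simp
  define F where "F = (\<lambda>s. SOME xs. set xs = {b \<in> B. norm (A b) = s} \<and> distinct xs)"
  have F: "set (F s) = {b \<in> B. norm (A b) = s}" "distinct (F s)" for s
    using someI_ex[OF finite_distinct_list[of "{b \<in> B. norm (A b) = s}"]] fin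
    by (auto simp: F_def)
  have lenF: "length (F s) = dim (singular_space V A s)" if "0 \<le> s" for s
    using distinct_card[OF F(2), of s] F(1) singular_space_eq_span(2)[OF V A B that] by simp
  define ss where "ss = rev (sorted_list_of_set S)"
  have ss: "set ss = S" "distinct ss" by (simp_all add: ss_def finS)
  define fs where "fs = concat (map F ss)"
  have set_fs: "set fs = B" unfolding fs_def using F(1) S ss(1) by auto
  have "distinct fs"
    unfolding fs_def
  proof (rule distinct_concat)
    have "inj_on F S"
    proof (rule inj_onI)
      fix s t assume st: "s \<in> S" "t \<in> S" "F s = F t"
      then obtain b where "b \<in> set (F s)" using S F(1) by auto
      with st(3) show "s = t" using F(1)[of s] F(1)[of t] by auto
    qed
    then show "distinct (map F ss)" using ss by (simp add: distinct_map)
  qed (use F in auto)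
  moreover have "singular_values V A = map (\<lambda>b. norm (A b)) fs"
  proof -
    have "map (\<lambda>b. norm (A b)) fs = concat (map (\<lambda>s. replicate (length (F s)) s) ss)"
      unfolding fs_def using F(1) by (intro map_concat_fibres) auto
    also have "\<dots> = concat (map (\<lambda>s. replicate (dim (singular_space V A s)) s) ss)"
      using lenF ss(1) S_def by (intro arg_cong[where f = concat] map_cong) auto
    finally show ?thesis by (simp add: singular_values_def ss_def S_def)
  qed
  ultimately show thesis using that[of fs] set_fs B by simp
qed

lemma length_singular_values:
  fixes A :: "'a::euclidean_space \<Rightarrow> 'b::euclidean_space"
  assumes "subspace V" "linear A"
  shows "length (singular_values V A) = dim V"
proof -
  obtain fs where fs: "distinct fs" "singular_basis V A (set fs)"
    "singular_values V A = map (\<lambda>b. norm (A b)) fs"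
    by (rule singular_basis_enumeration[OF assms])
  have "dim V = card (set fs)"
    using dim_span_orthonormal[of "set fs"] fs(2) unfolding singular_basis_def by metis
  then show ?thesis using fs(1,3) by (simp add: distinct_card)
qed

lemma singular_values_nonneg:
  fixes A :: "'a::euclidean_space \<Rightarrow> 'b::euclidean_space"
  assumes "subspace V" "linear A" "i < dim V"
  shows "0 \<le> singular_values V A ! i"
proof -
  obtain fs where "singular_values V A = map (\<lambda>b. norm (A b)) fs"
    by (rule singular_basis_enumeration[OF assms(1,2)])
  then show ?thesis
    using length_singular_values[OF assms(1,2)] assms(3) by simp
qed

lemma singular_values_antimono:
  fixes A :: "'a::euclidean_space \<Rightarrow> 'b::euclidean_space"
  assumes "subspace V" "linear A" "i \<le> j" "j < dim V"
  shows "singular_values V A ! j \<le> singular_values V A ! i"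
proof (cases "i = j")
  case False
  then have "i < j" "j < length (singular_values V A)"
    using assms length_singular_values[OF assms(1,2)] by auto
  then show ?thesis
    using singular_values_decreasing[of V A] unfolding sorted_wrt_iff_nth_less by blast
qed simp

lemma singular_value_multiplicity:
  fixes A :: "'a::euclidean_space \<Rightarrow> 'b::euclidean_space"
  assumes "subspace V" "linear A" "0 \<le> s"
  shows "card {i. i < dim V \<and> singular_values V A ! i = s} = dim (singular_space V A s)"
proof -
  obtain fs where fs: "distinct fs" "singular_basis V A (set fs)"
    "singular_values V A = map (\<lambda>b. norm (A b)) fs"
    by (rule singular_basis_enumeration[OF assms(1,2)])
  have len: "length fs = dim V" using length_singular_values[OF assms(1,2)] fs(3) by simp
  have "card {i. i < dim V \<and> singular_values V A ! i = s}
      = card {i. i < length fs \<and> norm (A (fs ! i)) = s}"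
    unfolding fs(3) len[symmetric] by (intro arg_cong[where f = card]) auto
  also have "\<dots> = length (filter (\<lambda>b. norm (A b) = s) fs)"
    by (simp add: length_filter_conv_card)
  also have "\<dots> = card {b \<in> set fs. norm (A b) = s}"
    using distinct_card[of "filter (\<lambda>b. norm (A b) = s) fs"] fs(1) by simp
  also have "\<dots> = dim (singular_space V A s)"
    using singular_space_eq_span(2)[OF assms(1,2) fs(2) assms(3)] by simp
  finally show ?thesis .
qed

text \<open>Applied to the positions at which the decreasing list of singular values equals \<open>1\<close>: knowing
  how many there are, one knows which they are.\<close>

lemma downward_closed_eq_lessThan_card:
  fixes S :: "nat set"
  assumes "finite S" and down: "\<And>i j. j \<in> S \<Longrightarrow> i \<le> j \<Longrightarrow> i \<in> S"
  shows "S = {..<card S}"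
proof -
  define n where "n = (LEAST i. i \<notin> S)"
  have "\<exists>i. i \<notin> S" by (rule ex_new_if_finite[OF infinite_UNIV_nat assms(1)])
  then have n: "n \<notin> S" unfolding n_def by (rule LeastI_ex)
  have S: "S = {..<n}"
  proof
    show "S \<subseteq> {..<n}"
    proof
      fix j assume "j \<in> S"
      then have "\<not> n \<le> j" using n down by blast
      then show "j \<in> {..<n}" by simp
    qed
    show "{..<n} \<subseteq> S"
    proof
      fix j assume "j \<in> {..<n}"
      then have "j < (LEAST i. i \<notin> S)" by (simp add: n_def)
      from not_less_Least[OF this] show "j \<in> S" by simp
    qed
  qed
  have "card S = n" unfolding S by simp
  then show ?thesis using S by simp
qed


section \<open>Principal angles\<close>

lemma orth_proj_symmetric:
  assumes "subspace W"
  shows "orth_proj W x \<bullet> y = x \<bullet> orth_proj W y"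
proof -
  have *: "orth_proj W x \<bullet> orth_proj W y = x \<bullet> orth_proj W y" for x y
    using orth_proj_subspace(2)[OF assms orth_proj_subspace(1)[OF assms], of x y]
    by (simp add: orthogonal_def inner_diff_left)
  show ?thesis using *[of x y] *[of y x] by (simp add: inner_commute)
qed

lemma orth_proj_id:
  assumes "subspace W" "x \<in> W"
  shows "orth_proj W x = x"
  using assms by (intro orth_proj_subspace_unique) (auto simp: orthogonal_def)

lemma orth_proj_inner_self:
  assumes "subspace W"
  shows "orth_proj W x \<bullet> x = (norm (orth_proj W x))\<^sup>2"
  using orth_proj_symmetric[OF assms, of "x" "orth_proj W x"]
    orth_proj_id[OF assms orth_proj_subspace(1)[OF assms, of x]]
  by (simp add: power2_norm_eq_inner inner_commute)

lemma norm_orth_proj_le: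
  assumes "subspace W"
  shows "norm (orth_proj W x) \<le> norm x"
proof -
  have "(norm (orth_proj W x))\<^sup>2 \<le> norm (orth_proj W x) * norm x"
    using norm_cauchy_schwarz[of "orth_proj W x" x] by (simp add: orth_proj_inner_self[OF assms])
  then show ?thesis by (cases "orth_proj W x = 0") (simp_all add: power2_eq_square)
qed

lemma adjoint_on_orth_proj:
  fixes U V :: "'a::euclidean_space set"
  assumes "subspace U"
  shows "adjoint_on V (orth_proj U) (orth_proj U x) = orth_proj V (orth_proj U x)"
proof -
  have "adjoint (orth_proj U) = orth_proj U"
    using orth_proj_symmetric[OF assms] by (intro adjoint_unique) auto
  then show ?thesis
    by (simp add: adjoint_on_def orth_proj_id[OF assms orth_proj_subspace(1)[OF assms]])
qed

lemma in_subspace_if_norm_orth_proj_eq: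
  assumes "subspace W" "norm (orth_proj W x) = norm x"
  shows "x \<in> W"
proof -
  have "(norm (x - orth_proj W x))\<^sup>2
      = (norm x)\<^sup>2 - 2 * (orth_proj W x \<bullet> x) + (norm (orth_proj W x))\<^sup>2"
    by (simp add: power2_norm_eq_inner inner_diff_left inner_diff_right inner_commute)
  also have "\<dots> = 0" using assms(2) by (simp add: orth_proj_inner_self[OF assms(1)])
  finally have "(norm (x - orth_proj W x))\<^sup>2 = 0" .
  then show ?thesis using orth_proj_subspace(1)[OF assms(1), of x] by simp
qed

text \<open>Projections do not increase norms, with equality only for vectors that are fixed.\<close>

lemma fixed_by_two_projections_iff:
  assumes U: "subspace U" and V: "subspace V" and x: "x \<in> V"
  shows "orth_proj V (orth_proj U x) = x \<longleftrightarrow> x \<in> U"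
proof
  assume "orth_proj V (orth_proj U x) = x"
  then have "norm x \<le> norm (orth_proj U x)" using norm_orth_proj_le[OF V, of "orth_proj U x"] by simp
  then show "x \<in> U"
    using norm_orth_proj_le[OF U, of x] by (intro in_subspace_if_norm_orth_proj_eq[OF U]) simp
qed (simp add: orth_proj_id U V x)

lemma singular_value_le_1:
  assumes U: "subspace U" and V: "subspace V" and i: "i < dim V"
  shows "singular_values V (orth_proj U) ! i \<le> 1"
proof -
  obtain fs where fs: "singular_basis V (orth_proj U) (set fs)"
    "singular_values V (orth_proj U) = map (\<lambda>b. norm (orth_proj U b)) fs"
    by (rule singular_basis_enumeration[OF V linear_orth_proj[OF U]])
  have "i < length fs"
    using length_singular_values[OF V linear_orth_proj[OF U]] i by (simp add: fs(2))
  then show ?thesis using fs norm_orth_proj_le[OF U, of "fs ! i"] by (simp add: singular_basis_def)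
qed

lemma cos_principal_angle:
  assumes U: "subspace U" and V: "subspace V" and k: "k \<in> {1..dim V}"
  shows "cos (principal_angle U V k) = singular_values V (orth_proj U) ! (k - 1)"
    and "0 \<le> principal_angle U V k" and "principal_angle U V k \<le> pi / 2"
proof -
  let ?s = "singular_values V (orth_proj U) ! (k - 1)"
  have i: "k - 1 < dim V" using k by auto
  have s: "0 \<le> ?s" "?s \<le> 1"
    using singular_values_nonneg[OF V linear_orth_proj[OF U] i] singular_value_le_1[OF U V i] .
  then show "cos (principal_angle U V k) = ?s" by (simp add: principal_angle_def)
  show "0 \<le> principal_angle U V k" using s by (simp add: principal_angle_def arccos_lbound)
  show "principal_angle U V k \<le> pi / 2" unfolding principal_angle_def using s by (intro arccos_le_pi2) auto
qed

lemma principal_angle_mono: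
  assumes U: "subspace U" and V: "subspace V" and jk: "1 \<le> j" "j \<le> k" "k \<le> dim V"
  shows "principal_angle U V j \<le> principal_angle U V k"
proof -
  let ?s = "singular_values V (orth_proj U)"
  have k: "k - 1 < dim V" "j - 1 \<le> k - 1" using jk by auto
  have "?s ! (k - 1) \<le> ?s ! (j - 1)"
    by (rule singular_values_antimono[OF V linear_orth_proj[OF U] k(2,1)])
  moreover have "0 \<le> ?s ! (k - 1)"
    by (rule singular_values_nonneg[OF V linear_orth_proj[OF U] k(1)])
  moreover have "?s ! (j - 1) \<le> 1" using k by (intro singular_value_le_1[OF U V]) auto
  ultimately show ?thesis unfolding principal_angle_def by (intro arccos_le_arccos) auto
qed

text \<open>The singular value \<open>1\<close> has eigenspace \<open>U \<inter> V\<close>, hence multiplicity \<open>dim (U \<inter> V)\<close>, and it is the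
  largest possible one, so it occupies the front of the list. Consequently the Friedrichs angle is
  positive.\<close>

lemma principal_angle_eq_0_iff:
  assumes U: "subspace U" and V: "subspace V" and k: "k \<in> {1..dim V}"
  shows "principal_angle U V k = 0 \<longleftrightarrow> k \<le> dim (U \<inter> V)"
proof -
  let ?s = "singular_values V (orth_proj U)"
  note lin = linear_orth_proj[OF U]
  let ?S = "{i. i < dim V \<and> ?s ! i = 1}"
  have "singular_space V (orth_proj U) 1 = U \<inter> V"
    using fixed_by_two_projections_iff[OF U V]
    by (auto simp: singular_space_def adjoint_on_orth_proj[OF U])
  then have card: "card ?S = dim (U \<inter> V)"
    using singular_value_multiplicity[OF V lin, of 1] by simp
  have "?S = {..<card ?S}"
  proof (rule downward_closed_eq_lessThan_card)
    fix i j assume j: "j \<in> ?S" "i \<le> j"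
    then have "?s ! i \<le> 1" by (intro singular_value_le_1[OF U V]) auto
    moreover have "?s ! j \<le> ?s ! i"
      using singular_values_antimono[OF V lin] j by blast
    ultimately show "i \<in> ?S" using j by auto
  qed simp
  then have "k - 1 \<in> ?S \<longleftrightarrow> k - 1 < dim (U \<inter> V)" using card by auto
  then have "?s ! (k - 1) = 1 \<longleftrightarrow> k \<le> dim (U \<inter> V)" using k by auto
  moreover have "?s ! (k - 1) = 1 \<longleftrightarrow> principal_angle U V k = 0"
    using cos_principal_angle[OF U V k] cos_inj_pi[of "principal_angle U V k" 0] by auto
  ultimately show ?thesis by simp
qed

text \<open>The left singular vectors are \<open>e k = P\<^sub>U (f k) / cos \<theta>\<^sub>k\<close>. They are orthonormal because
  \<open>P\<^sub>U (f j) \<bullet> P\<^sub>U (f k) = f j \<bullet> P\<^sub>V (P\<^sub>U (f k))\<close> and \<open>f k\<close> is an eigenvector of \<open>P\<^sub>V P\<^sub>U\<close>.\<close>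

lemma principal_frame_exists:
  assumes U: "subspace U" and V: "subspace V"
  shows "\<exists>f e. principal_frame U V f e"
proof -
  note lin = linear_orth_proj[OF U]
  obtain fs where dist: "distinct fs" and basis: "singular_basis V (orth_proj U) (set fs)"
    and sv: "singular_values V (orth_proj U) = map (\<lambda>b. norm (orth_proj U b)) fs"
    by (rule singular_basis_enumeration[OF V lin])
  have fs: "pairwise orthogonal (set fs)" "\<And>b. b \<in> set fs \<Longrightarrow> norm b = 1" "span (set fs) = V"
    "\<And>b. b \<in> set fs \<Longrightarrow>
      adjoint_on V (orth_proj U) (orth_proj U b) = (norm (orth_proj U b))\<^sup>2 *\<^sub>R b"
    using basis unfolding singular_basis_def by blast+
  have len: "length fs = dim V" using length_singular_values[OF V lin] by (simp add: sv)
  define f where "f k = fs ! (k - 1)" for k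
  define c where "c k = cos (principal_angle U V k)" for k
  define e where "e k = (1 / c k) *\<^sub>R orth_proj U (f k)" for k
  define K where "K = {k \<in> {1..dim V}. principal_angle U V k < pi / 2}"
  have f_in: "f k \<in> set fs" if "k \<in> {1..dim V}" for k
    using that len by (auto simp: f_def)
  have c: "c k = norm (orth_proj U (f k))" if "k \<in> {1..dim V}" for k
    using cos_principal_angle(1)[OF U V that] that len by (auto simp: c_def f_def sv)
  have img: "f ` {1..dim V} = set fs"
  proof
    show "set fs \<subseteq> f ` {1..dim V}"
    proof
      fix b assume "b \<in> set fs"
      then obtain i where "i < dim V" "b = fs ! i" by (metis in_set_conv_nth len)
      then show "b \<in> f ` {1..dim V}" by (intro image_eqI[of _ _ "Suc i"]) (auto simp: f_def)
    qed
  qed (use f_in in auto)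
  have on: "f j \<bullet> f k = (if j = k then 1 else 0)" if "j \<in> {1..dim V}" "k \<in> {1..dim V}" for j k
  proof (cases "j = k")
    case True
    then show ?thesis using fs(2)[OF f_in[OF that(1)]] by (simp add: norm_eq_1)
  next
    case False
    then have "f j \<noteq> f k" using dist that len by (auto simp: f_def nth_eq_iff_index_eq)
    then show ?thesis
      using False fs(1) f_in that by (auto simp: pairwise_def orthogonal_def)
  qed
  have TT: "orth_proj V (orth_proj U (f k)) = (c k)\<^sup>2 *\<^sub>R f k" if "k \<in> {1..dim V}" for k
    using fs(4)[OF f_in[OF that]] c[OF that] by (simp add: adjoint_on_orth_proj[OF U])
  have PP: "orth_proj U (f j) \<bullet> orth_proj U (f k) = (c k)\<^sup>2 * (f j \<bullet> f k)"
    if "j \<in> {1..dim V}" "k \<in> {1..dim V}" for j k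
  proof -
    have "f j \<in> V" using f_in[OF that(1)] fs(3) span_base by blast
    have "orth_proj U (f j) \<bullet> orth_proj U (f k) = f j \<bullet> orth_proj U (f k)"
      by (simp add: orth_proj_symmetric[OF U] orth_proj_id[OF U orth_proj_subspace(1)[OF U]])
    also have "\<dots> = f j \<bullet> orth_proj V (orth_proj U (f k))"
      using orth_proj_symmetric[OF V, of "f j"] orth_proj_id[OF V \<open>f j \<in> V\<close>] by simp
    finally show ?thesis by (simp add: TT[OF that(2)])
  qed
  have cK: "0 < c k" "k \<in> {1..dim V}" if "k \<in> K" for k
    using that cos_principal_angle(2)[OF U V, of k]
    by (auto simp: K_def c_def intro!: cos_gt_zero_pi)
  have "orthonormal_family {1..dim V} f" using on by (auto simp: orthonormal_family_def)
  moreover have "orthonormal_family K e"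
    unfolding orthonormal_family_def
  proof (intro ballI)
    fix j k assume jk: "j \<in> K" "k \<in> K"
    show "e j \<bullet> e k = (if j = k then 1 else 0)"
      using cK[OF jk(1)] cK[OF jk(2)]
      by (auto simp: e_def PP on power2_eq_square)
  qed
  moreover have "e ` K \<subseteq> U"
    using orth_proj_subspace(1)[OF U] subspace_scale[OF U] by (auto simp: e_def)
  moreover have "\<forall>k\<in>K. orth_proj U (f k) = c k *\<^sub>R e k \<and> orth_proj V (e k) = c k *\<^sub>R f k"
  proof
    fix k assume k: "k \<in> K"
    show "orth_proj U (f k) = c k *\<^sub>R e k \<and> orth_proj V (e k) = c k *\<^sub>R f k"
      using cK[OF k] TT[of k]
      by (simp add: e_def linear_cmul[OF linear_orth_proj[OF V]] power2_eq_square)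
  qed
  moreover have "\<forall>k\<in>{1..dim V} - K. orth_proj U (f k) = 0"
  proof
    fix k assume "k \<in> {1..dim V} - K"
    then have k: "k \<in> {1..dim V}" "principal_angle U V k = pi / 2"
      using cos_principal_angle(3)[OF U V, of k] by (auto simp: K_def)
    from k(2) have "c k = 0" by (simp only: c_def cos_pi_half)
    then show "orth_proj U (f k) = 0" using c[OF k(1)] by simp
  qed
  ultimately have "principal_frame U V f e"
    unfolding principal_frame_def Let_def K_def[symmetric] c_def[symmetric] img
    using fs(3) by (intro conjI) assumption+
  then show ?thesis by blast
qed

section \<open>The circumcentered-reflection step as a line search\<close>

text \<open>On \<open>V\<close> this is \<open>Id - P\<^sub>V P\<^sub>U\<close>, a symmetric positive semidefinite operator with kernel
  \<open>U \<inter> V\<close> and with eigenvalues the squared sines of the principal angles.\<close>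

definition defect :: "'a::euclidean_space set \<Rightarrow> 'a set \<Rightarrow> 'a \<Rightarrow> 'a" where
  "defect U V v = v - orth_proj V (orth_proj U v)"

text \<open>The point of smallest norm on the line through \<open>w\<close> in direction \<open>b\<close>. For \<open>b = 0\<close> the quotient
  is \<open>0\<close> and the value is \<open>w\<close>, the only point there is.\<close>

definition line_min :: "'a::real_inner \<Rightarrow> 'a \<Rightarrow> 'a" where
  "line_min w b = w - ((w \<bullet> b) / (b \<bullet> b)) *\<^sub>R b"

lemma linear_defect:
  assumes "subspace U" "subspace V"
  shows "linear (defect U V)"
  unfolding defect_def
  using linear_compose[OF linear_orth_proj[OF assms(1)] linear_orth_proj[OF assms(2)]]
  by (intro linear_compose_sub linear_id[unfolded id_def]) (simp add: o_def)

lemma defect_in: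
  assumes "subspace V" "v \<in> V"
  shows "defect U V v \<in> V"
  unfolding defect_def using assms by (intro subspace_diff orth_proj_subspace(1))

lemma defect_symmetric:
  assumes U: "subspace U" and V: "subspace V" and "v \<in> V" "w \<in> V"
  shows "defect U V v \<bullet> w = v \<bullet> defect U V w"
proof -
  have "orth_proj V (orth_proj U v) \<bullet> w = v \<bullet> orth_proj U w"
    unfolding orth_proj_symmetric[OF V] orth_proj_id[OF V assms(4)] by (rule orth_proj_symmetric[OF U])
  also have "\<dots> = v \<bullet> orth_proj V (orth_proj U w)"
    using orth_proj_symmetric[OF V, of v "orth_proj U w"] orth_proj_id[OF V assms(3)] by simp
  finally have "orth_proj V (orth_proj U v) \<bullet> w = v \<bullet> orth_proj V (orth_proj U w)" .
  then show ?thesis by (simp add: defect_def inner_diff_left inner_diff_right)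
qed

lemma defect_eq_0_iff:
  assumes "subspace U" "subspace V" "v \<in> V"
  shows "defect U V v = 0 \<longleftrightarrow> v \<in> U"
  using fixed_by_two_projections_iff[OF assms] by (auto simp: defect_def)

lemma norm_reflection:
  assumes "subspace W"
  shows "norm (reflection W x) = norm x"
proof -
  have "(norm (reflection W x))\<^sup>2 = (norm x)\<^sup>2"
    using orth_proj_inner_self[OF assms, of x]
    by (simp add: reflection_def power2_norm_eq_inner inner_diff_left inner_diff_right inner_commute)
  then show ?thesis by simp
qed

text \<open>The midpoint \<open>m\<close> of the last two vertices \<open>y\<close> and \<open>z\<close> is \<open>P\<^sub>V y\<close>, and \<open>m - v = - 2 b\<close> for the
  defect \<open>b\<close> of \<open>v\<close>. The point \<open>c\<close> of smallest norm on the line through \<open>v\<close> and \<open>m\<close> lies in the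
  affine hull of the vertices and is orthogonal to \<open>b\<close>; since \<open>c \<in> V\<close> it is also orthogonal to
  \<open>y - m\<close>. These two directions span the hull, so \<open>c\<close> is the projection of \<open>0\<close>, which is equidistant
  from the vertices because reflections preserve norms.\<close>

lemma crm_op_eq_line_min:
  assumes U: "subspace U" and V: "subspace V" and v: "v \<in> V"
  shows "crm_op U V v = line_min v (defect U V v)"
proof -
  define b where "b = defect U V v"
  define c where "c = line_min v b"
  define y where "y = reflection U v"
  define z where "z = reflection V y"
  define m where "m = orth_proj V y"
  let ?H = "affine hull {v, y, z}"
  have bV: "b \<in> V" unfolding b_def by (rule defect_in[OF V v])
  have cV: "c \<in> V" unfolding c_def line_min_def by (intro subspace_diff[OF V] subspace_scale[OF V] v bV)
  have mV: "m \<in> V" unfolding m_def by (rule orth_proj_subspace(1)[OF V])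
  have m: "m = v - 2 *\<^sub>R b"
  proof -
    have "m = 2 *\<^sub>R orth_proj V (orth_proj U v) - v"
      by (simp add: m_def y_def reflection_def linear_diff[OF linear_orth_proj[OF V]]
          linear_cmul[OF linear_orth_proj[OF V]] orth_proj_id[OF V v])
    then show ?thesis by (simp add: b_def defect_def scaleR_right_diff_distrib scaleR_2)
  qed
  have z: "z = 2 *\<^sub>R m - y" by (simp add: z_def m_def reflection_def)
  have cb: "c \<bullet> b = 0" by (simp add: c_def line_min_def inner_diff_left)
  then have cm: "c \<bullet> m = c \<bullet> v" by (simp add: m inner_diff_right)
  have cy: "c \<bullet> y = c \<bullet> v"
    using orth_proj_subspace(2)[OF V cV, of y] cm
    by (simp add: m_def orthogonal_def inner_diff_right inner_commute[of _ c])
  have cz: "c \<bullet> z = c \<bullet> v" using cm cy by (simp add: z inner_diff_right)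
  have mH: "m \<in> ?H"
  proof -
    have "(1/2) *\<^sub>R y + (1/2) *\<^sub>R z \<in> ?H"
      by (rule mem_affine[OF affine_affine_hull]) (simp_all add: hull_inc)
    then show ?thesis by (simp add: z algebra_simps)
  qed
  have cH: "c \<in> ?H"
  proof -
    define t where "t = (v \<bullet> b) / (b \<bullet> b) / 2"
    have "(1 - t) *\<^sub>R v + t *\<^sub>R m \<in> ?H"
      using mH by (intro mem_affine[OF affine_affine_hull]) (simp_all add: hull_inc)
    moreover have "c = (1 - t) *\<^sub>R v + t *\<^sub>R m"
      by (simp add: c_def line_min_def m t_def algebra_simps)
    ultimately show ?thesis by simp
  qed
  have "?H \<subseteq> {x. c \<bullet> x = c \<bullet> v}"
    using cy cz by (intro hull_minimal) (auto simp: affine_hyperplane)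
  then have hull: "c \<bullet> x = c \<bullet> v" if "x \<in> ?H" for x using that by blast
  have "orth_proj ?H 0 = c"
  proof (rule orth_proj_unique[OF cH])
    fix x assume "x \<in> ?H"
    then show "orthogonal (0 - c) (x - c)"
      using hull[of x] hull[OF cH] by (simp add: orthogonal_def inner_diff_right)
  qed
  moreover have "equidistant {v, y, z} 0"
    by (simp add: equidistant_def y_def z_def norm_reflection[OF U] norm_reflection[OF V])
  ultimately have "circumcenter {v, y, z} = c" using circumcenter_eq[of "{v, y, z}" 0] by simp
  then show ?thesis by (simp add: crm_op_def y_def z_def c_def b_def)
qed

lemma defect_orthogonal_Int:
  assumes U: "subspace U" and V: "subspace V" and "w \<in> V" "z \<in> U \<inter> V"
  shows "defect U V w \<bullet> z = 0"
  using defect_symmetric[OF U V, of w z] defect_eq_0_iff[OF U V, of z] assms(3,4) by auto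

text \<open>Translating by a point of \<open>U \<inter> V\<close> changes neither the defect nor its inner product with \<open>v\<close>, so
  the step may be studied on the component orthogonal to \<open>U \<inter> V\<close>.\<close>

lemma crm_op_residual:
  assumes U: "subspace U" and V: "subspace V" and v: "v \<in> V" and z: "z \<in> U \<inter> V"
  shows "crm_op U V v - z = line_min (v - z) (defect U V (v - z))"
proof -
  have "defect U V (v - z) = defect U V v"
    using z defect_eq_0_iff[OF U V, of z] by (simp add: linear_diff[OF linear_defect[OF U V]])
  moreover have "z \<bullet> defect U V v = 0"
    using defect_orthogonal_Int[OF U V v z] by (simp add: inner_commute)
  ultimately show ?thesis
    by (simp add: crm_op_eq_line_min[OF U V v] line_min_def inner_diff_left)
qed

lemma crm_op_invariants:
  assumes U: "subspace U" and V: "subspace V" and v: "v \<in> V"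
  shows "crm_op U V v \<in> V" and "orth_proj (U \<inter> V) (crm_op U V v) = orth_proj (U \<inter> V) v"
proof -
  show "crm_op U V v \<in> V"
    unfolding crm_op_eq_line_min[OF U V v] line_min_def
    by (intro subspace_diff[OF V] subspace_scale[OF V] v defect_in[OF V])
  have UV: "subspace (U \<inter> V)" using U V by (rule subspace_inter)
  show "orth_proj (U \<inter> V) (crm_op U V v) = orth_proj (U \<inter> V) v"
  proof (rule orth_proj_subspace_unique[OF UV orth_proj_subspace(1)[OF UV]])
    fix z assume z: "z \<in> U \<inter> V"
    show "orthogonal (crm_op U V v - orth_proj (U \<inter> V) v) z"
      using orth_proj_subspace(2)[OF UV z, of v] defect_orthogonal_Int[OF U V v z]
      by (simp add: crm_op_eq_line_min[OF U V v] line_min_def orthogonal_def inner_diff_left)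
  qed
qed


section \<open>The Kantorovich inequality in an orthonormal family\<close>

lemma norm_line_min:
  "(norm (line_min w b))\<^sup>2 = (norm w)\<^sup>2 - (w \<bullet> b)\<^sup>2 / (b \<bullet> b)"
proof (cases "b = 0")
  case False
  define t where "t = (w \<bullet> b) / (b \<bullet> b)"
  have t: "t * (b \<bullet> b) = w \<bullet> b" using False by (simp add: t_def)
  have "(norm (line_min w b))\<^sup>2 = w \<bullet> w - 2 * t * (w \<bullet> b) + t * (t * (b \<bullet> b))"
    unfolding line_min_def t_def[symmetric] power2_norm_eq_inner
    by (simp add: inner_diff_left inner_diff_right inner_commute[of b w] algebra_simps)
  also have "\<dots> = w \<bullet> w - t * (w \<bullet> b)" unfolding t by simp
  also have "\<dots> = (norm w)\<^sup>2 - (w \<bullet> b)\<^sup>2 / (b \<bullet> b)"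
    unfolding power2_norm_eq_inner by (simp add: t_def power2_eq_square)
  finally show ?thesis .
qed (simp add: line_min_def)

lemma orthonormal_family_expand:
  assumes f: "orthonormal_family I f" and fin: "finite I" and x: "x \<in> span (f ` I)"
  shows "x \<bullet> y = (\<Sum>i\<in>I. (x \<bullet> f i) * (y \<bullet> f i))"
proof -
  have inj: "inj_on f I"
  proof (rule inj_onI)
    fix i j assume ij: "i \<in> I" "j \<in> I" "f i = f j"
    have "f i \<bullet> f i = 1" "f i \<bullet> f j = (if i = j then 1 else 0)"
      using f ij(1,2) unfolding orthonormal_family_def by simp_all
    then show "i = j" using ij(3) by (simp split: if_splits)
  qed
  have "pairwise orthogonal (f ` I)"
    using f by (auto simp: pairwise_def orthogonal_def orthonormal_family_def)
  moreover have "norm b = 1" if "b \<in> f ` I" for b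
    using that f by (auto simp: norm_eq_1 orthonormal_family_def)
  ultimately have "x = (\<Sum>b\<in>f ` I. (x \<bullet> b) *\<^sub>R b)"
    using x fin by (intro orthonormal_basis_expand[symmetric]) auto
  also have "\<dots> = (\<Sum>i\<in>I. (x \<bullet> f i) *\<^sub>R f i)" by (simp add: sum.reindex[OF inj])
  finally have "x \<bullet> y = (\<Sum>i\<in>I. (x \<bullet> f i) *\<^sub>R f i) \<bullet> y" by simp
  then show ?thesis by (simp only: inner_sum_left inner_scaleR_left inner_commute[of y])
qed

text \<open>If \<open>m \<le> l i \<le> M\<close> then \<open>(l i - m) (l i - M) \<le> 0\<close>. Summed against the squared coefficients of
  \<open>w\<close> this gives \<open>b \<bullet> b + m M (w \<bullet> w) \<le> (M + m) (w \<bullet> b)\<close>, and the inequality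
  \<open>4 x y \<le> (x + y)\<^sup>2\<close> bounds the left-hand side from below in terms of the product of its two summands.
  The condition on \<open>l i\<close> is only imposed where \<open>w\<close> has a component, since in the application the
  vectors of \<open>U \<inter> V\<close> have eigenvalue \<open>0\<close>.\<close>

lemma kantorovich_line_min:
  assumes f: "orthonormal_family I f" and fin: "finite I"
    and w: "w \<in> span (f ` I)" and b: "b \<in> span (f ` I)"
    and coeff: "\<And>i. i \<in> I \<Longrightarrow> b \<bullet> f i = l i * (w \<bullet> f i)"
    and bounds: "\<And>i. i \<in> I \<Longrightarrow> w \<bullet> f i = 0 \<or> m \<le> l i \<and> l i \<le> M"
    and m: "0 < m" "m \<le> M"
  shows "norm (line_min w b) \<le> (M - m) / (M + m) * norm w"
proof -
  have "b \<bullet> b - (M + m) * (w \<bullet> b) + m * M * (w \<bullet> w)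
      = (\<Sum>i\<in>I. (l i - m) * (l i - M) * (w \<bullet> f i)\<^sup>2)"
    unfolding orthonormal_family_expand[OF f fin w, of w] orthonormal_family_expand[OF f fin w, of b]
      orthonormal_family_expand[OF f fin b, of b]
      sum_distrib_left sum_subtractf[symmetric] sum.distrib[symmetric]
    by (intro sum.cong refl) (simp add: coeff algebra_simps power2_eq_square)
  also have "\<dots> \<le> 0"
  proof (rule sum_nonpos)
    fix i assume "i \<in> I"
    show "(l i - m) * (l i - M) * (w \<bullet> f i)\<^sup>2 \<le> 0"
    proof (cases "w \<bullet> f i = 0")
      case False
      with bounds[OF \<open>i \<in> I\<close>] have "(l i - m) * (l i - M) \<le> 0" by (intro mult_nonneg_nonpos) auto
      then show ?thesis by (rule mult_nonpos_nonneg) simp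
    qed simp
  qed
  finally have key: "b \<bullet> b + m * M * (w \<bullet> w) \<le> (M + m) * (w \<bullet> b)" by simp
  have "(norm (line_min w b))\<^sup>2 \<le> ((M - m) / (M + m) * norm w)\<^sup>2"
  proof (cases "b = 0")
    case True
    then have "m * M * (w \<bullet> w) \<le> 0" using key by simp
    then have "w \<bullet> w \<le> 0" using m by (simp add: mult_le_0_iff)
    then have "w = 0" using inner_ge_zero[of w] by (metis inner_eq_zero_iff order_antisym)
    then show ?thesis using True by (simp add: line_min_def)
  next
    case False
    then have bb: "0 < b \<bullet> b" by simp
    have pos: "0 < (M + m)\<^sup>2" using m by simp
    have "4 * (b \<bullet> b) * (m * M * (w \<bullet> w)) \<le> (b \<bullet> b + m * M * (w \<bullet> w))\<^sup>2"
      using zero_le_power2[of "b \<bullet> b - m * M * (w \<bullet> w)"]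
      by (simp add: power2_eq_square algebra_simps)
    also have "\<dots> \<le> ((M + m) * (w \<bullet> b))\<^sup>2" using m by (intro power_mono key) simp
    finally have "4 * (b \<bullet> b) * (m * M * (w \<bullet> w)) \<le> (M + m)\<^sup>2 * (w \<bullet> b)\<^sup>2"
      by (simp add: power_mult_distrib)
    then have "4 * m * M * (w \<bullet> w) * (b \<bullet> b) \<le> (M + m)\<^sup>2 * (w \<bullet> b)\<^sup>2" by (simp add: mult_ac)
    then have "4 * m * M * (w \<bullet> w) \<le> (M + m)\<^sup>2 * (w \<bullet> b)\<^sup>2 / (b \<bullet> b)"
      by (simp only: pos_le_divide_eq[OF bb])
    then have "4 * m * M * (w \<bullet> w) \<le> (w \<bullet> b)\<^sup>2 / (b \<bullet> b) * (M + m)\<^sup>2"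
      by (simp add: mult.commute)
    then have "4 * m * M * (w \<bullet> w) / (M + m)\<^sup>2 \<le> (w \<bullet> b)\<^sup>2 / (b \<bullet> b)"
      by (simp only: pos_divide_le_eq[OF pos])
    moreover have "((M - m) / (M + m) * norm w)\<^sup>2 = w \<bullet> w - 4 * m * M * (w \<bullet> w) / (M + m)\<^sup>2"
    proof -
      have "(M - m)\<^sup>2 = (M + m)\<^sup>2 - 4 * m * M" by (simp add: power2_eq_square algebra_simps)
      then have "((M - m) / (M + m))\<^sup>2 = ((M + m)\<^sup>2 - 4 * m * M) / (M + m)\<^sup>2"
        by (simp only: power_divide)
      also have "\<dots> = 1 - 4 * m * M / (M + m)\<^sup>2"
        using m by (simp add: diff_divide_distrib)
      finally have "((M - m) / (M + m))\<^sup>2 = 1 - 4 * m * M / (M + m)\<^sup>2" .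
      then show ?thesis
        by (simp only: power_mult_distrib power2_norm_eq_inner) (simp add: left_diff_distrib)
    qed
    ultimately show ?thesis unfolding norm_line_min by (simp add: power2_norm_eq_inner)
  qed
  then show ?thesis by (rule power2_le_imp_le) (use m in simp)
qed

text \<open>Both inequalities in the proof of the bound become equalities when only the extreme eigenvalues
  occur and the weights are \<open>\<surd>M\<close> on the eigenvalue \<open>m\<close> and \<open>\<surd>m\<close> on the eigenvalue \<open>M\<close>. The case
  \<open>f = g\<close> is that of a single nonzero principal angle, where one step reaches the limit.\<close>

lemma kantorovich_line_min_sharp:
  assumes "norm f = 1" "norm g = 1" and fg: "f \<bullet> g = 0 \<or> f = g \<and> m = M"
    and m: "0 < m" "m \<le> M" and "a\<^sup>2 = M" "c\<^sup>2 = m" "0 \<le> a" "0 \<le> c"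
  shows "norm (line_min (a *\<^sub>R f + c *\<^sub>R g) ((a * m) *\<^sub>R f + (c * M) *\<^sub>R g))
    = (M - m) / (M + m) * norm (a *\<^sub>R f + c *\<^sub>R g)"
  using fg
proof
  assume fg: "f \<bullet> g = 0"
  let ?w = "a *\<^sub>R f + c *\<^sub>R g" and ?b = "(a * m) *\<^sub>R f + (c * M) *\<^sub>R g"
  have gf: "g \<bullet> f = 0" using fg by (simp add: inner_commute)
  have n: "f \<bullet> f = 1" "g \<bullet> g = 1" using assms(1,2) by (simp_all add: norm_eq_1)
  have ac: "a * a = M" "c * c = m" using assms(6,7) by (simp_all add: power2_eq_square)
  have "?w \<bullet> ?w = a * a + c * c" by (simp add: inner_add_left inner_add_right fg gf n)
  then have ww: "(norm ?w)\<^sup>2 = M + m" by (simp add: power2_norm_eq_inner ac)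
  have "?w \<bullet> ?b = (a * a) * m + (c * c) * M"
    by (simp add: inner_add_left inner_add_right fg gf n)
  then have wb: "?w \<bullet> ?b = 2 * m * M" by (simp add: ac)
  have "?b \<bullet> ?b = (a * a) * (m * m) + (c * c) * (M * M)"
    by (simp add: inner_add_left inner_add_right fg gf n)
  then have bb: "?b \<bullet> ?b = m * M * (M + m)" by (simp add: ac algebra_simps)
  have "(norm (line_min ?w ?b))\<^sup>2 = ((M - m) / (M + m) * norm ?w)\<^sup>2"
  proof -
    define t where "t = M + m"
    have t: "t \<noteq> 0" "m \<noteq> 0" "M \<noteq> 0" using m by (auto simp: t_def)
    have "(M + m) - (2 * m * M)\<^sup>2 / (m * M * (M + m)) = (t\<^sup>2 - 4 * m * M) / t"
      unfolding t_def[symmetric] using t by (simp add: diff_divide_distrib power2_eq_square)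
    also have "t\<^sup>2 - 4 * m * M = (M - m)\<^sup>2" by (simp add: t_def power2_eq_square algebra_simps)
    also have "(M - m)\<^sup>2 / t = ((M - m) / t)\<^sup>2 * t"
      using t by (simp add: power_divide power2_eq_square)
    finally show ?thesis
      unfolding norm_line_min power_mult_distrib[of "(M - m) / (M + m)"] ww wb bb
      by (simp only: t_def)
  qed
  then show ?thesis by (rule power2_eq_imp_eq) (use m in simp_all)
next
  assume eq: "f = g \<and> m = M"
  have "a\<^sup>2 = c\<^sup>2" using assms(6,7) eq by simp
  then have "a = c" using assms(8,9) by (rule power2_eq_imp_eq)
  then have b: "(a * m) *\<^sub>R f + (c * M) *\<^sub>R g = m *\<^sub>R (a *\<^sub>R f + c *\<^sub>R g)"
    using eq by (simp add: scaleR_add_right mult.commute)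
  have "line_min w (m *\<^sub>R w) = 0" for w :: 'a
    using m by (cases "w = 0") (simp_all add: line_min_def)
  then show ?thesis unfolding b using eq by simp
qed

section \<open>The defect in a principal-angle frame\<close>

lemma dim_Int_less:
  fixes U V :: "'a::euclidean_space set"
  assumes "subspace U" "subspace V" "\<not> V \<subseteq> U"
  shows "dim (U \<inter> V) < dim V"
proof (rule ccontr)
  assume "\<not> dim (U \<inter> V) < dim V"
  then have "U \<inter> V = V"
    using subspace_dim_equal[OF subspace_inter[OF assms(1,2)] assms(2)] by simp
  then show False using assms(3) by blast
qed

lemma sin_principal_angle_bounds:
  assumes U: "subspace U" and V: "subspace V" and k: "dim (U \<inter> V) < k" "k \<le> dim V"
  shows "0 < sin (friedrichs_angle U V)"
    and "sin (friedrichs_angle U V) \<le> sin (principal_angle U V k)"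
    and "sin (principal_angle U V k) \<le> sin (largest_angle U V)"
proof -
  let ?a = "principal_angle U V"
  let ?F = "dim (U \<inter> V) + 1"
  have F: "?F \<in> {1..dim V}" and kin: "k \<in> {1..dim V}" and p: "dim V \<in> {1..dim V}"
    using k by auto
  have "?a ?F \<noteq> 0" using principal_angle_eq_0_iff[OF U V F] by simp
  then have F0: "0 < ?a ?F" using cos_principal_angle(2)[OF U V F] by simp
  moreover have "?a ?F \<le> pi / 2" by (rule cos_principal_angle(3)[OF U V F])
  ultimately show "0 < sin (friedrichs_angle U V)"
    unfolding friedrichs_angle_def using pi_gt_zero by (intro sin_gt_zero) linarith+
  have "?a ?F \<le> ?a k" "?a k \<le> ?a (dim V)"
    using k by (auto intro!: principal_angle_mono[OF U V])
  moreover have "?a k \<le> pi / 2" "?a (dim V) \<le> pi / 2"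
    using cos_principal_angle(3)[OF U V] kin p by blast+
  moreover have "0 \<le> ?a k" by (rule cos_principal_angle(2)[OF U V kin])
  ultimately show "sin (friedrichs_angle U V) \<le> sin (?a k)" "sin (?a k) \<le> sin (largest_angle U V)"
    unfolding friedrichs_angle_def largest_angle_def using F0
    by (auto intro!: sin_monotone_2pi_le)
qed

lemma principal_frameD:
  assumes "principal_frame U V f e"
  shows "orthonormal_family {1..dim V} f" and "span (f ` {1..dim V}) = V"
    and "k \<in> {1..dim V} \<Longrightarrow> f k \<in> V" and "k \<in> {1..dim V} \<Longrightarrow> norm (f k) = 1"
proof -
  show o: "orthonormal_family {1..dim V} f" and s: "span (f ` {1..dim V}) = V"
    using assms unfolding principal_frame_def Let_def by blast+
  show "f k \<in> V" if "k \<in> {1..dim V}"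
    using span_base[of "f k" "f ` {1..dim V}"] that unfolding s by blast
  show "norm (f k) = 1" if "k \<in> {1..dim V}"
    using o that unfolding orthonormal_family_def norm_eq_1 by simp
qed

text \<open>At \<open>\<theta>\<^sub>k = \<pi>/2\<close> the frame prescribes only \<open>P\<^sub>U (f k) = 0\<close>, which agrees with the general formula as
  \<open>cos \<theta>\<^sub>k = 0\<close>.\<close>

lemma defect_principal_vector:
  assumes U: "subspace U" and V: "subspace V" and f: "principal_frame U V f e"
    and k: "k \<in> {1..dim V}"
  shows "defect U V (f k) = (sin (principal_angle U V k))\<^sup>2 *\<^sub>R f k"
proof -
  let ?t = "principal_angle U V k"
  have "orth_proj V (orth_proj U (f k)) = (cos ?t)\<^sup>2 *\<^sub>R f k"
  proof (cases "?t < pi / 2")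
    case True
    then have "orth_proj U (f k) = cos ?t *\<^sub>R e k" "orth_proj V (e k) = cos ?t *\<^sub>R f k"
      using f k unfolding principal_frame_def Let_def by blast+
    then show ?thesis by (simp add: linear_cmul[OF linear_orth_proj[OF V]] power2_eq_square)
  next
    case False
    then have "?t = pi / 2" using cos_principal_angle(3)[OF U V k] by simp
    then have "cos ?t = 0" by (simp only: cos_pi_half)
    moreover have "orth_proj U (f k) = 0"
      using f k False unfolding principal_frame_def Let_def by blast
    ultimately show ?thesis by (simp add: linear_0[OF linear_orth_proj[OF V]])
  qed
  then show ?thesis by (simp add: defect_def sin_squared_eq scaleR_left_diff_distrib)
qed

text \<open>The defect is diagonal in a principal-angle frame. The component of \<open>v\<close> orthogonal to \<open>U \<inter> V\<close>
  involves only frame vectors whose angle lies between the Friedrichs angle and the largest one,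
  because the earlier frame vectors belong to \<open>U \<inter> V\<close>.\<close>

lemma crm_step_contraction:
  assumes U: "subspace U" and V: "subspace V" and VU: "\<not> V \<subseteq> U" and v: "v \<in> V"
  shows "norm (crm_op U V v - orth_proj (U \<inter> V) v)
    \<le> crm_rate U V * norm (v - orth_proj (U \<inter> V) v)"
proof -
  have UV: "subspace (U \<inter> V)" using U V by (rule subspace_inter)
  define z where "z = orth_proj (U \<inter> V) v"
  have z: "z \<in> U \<inter> V" unfolding z_def by (rule orth_proj_subspace(1)[OF UV])
  define w where "w = v - z"
  have wV: "w \<in> V" using v z V by (simp add: w_def subspace_diff)
  obtain f e where fe: "principal_frame U V f e" using principal_frame_exists[OF U V] by blast
  note f = principal_frameD[OF fe]
  let ?l = "\<lambda>k. (sin (principal_angle U V k))\<^sup>2"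
  have coeff: "defect U V w \<bullet> f k = ?l k * (w \<bullet> f k)" if "k \<in> {1..dim V}" for k
    using defect_symmetric[OF U V wV f(3)[OF that]] defect_principal_vector[OF U V fe that] by simp
  have bounds: "w \<bullet> f k = 0 \<or>
      (sin (friedrichs_angle U V))\<^sup>2 \<le> ?l k \<and> ?l k \<le> (sin (largest_angle U V))\<^sup>2"
    if k: "k \<in> {1..dim V}" for k
  proof (cases "k \<le> dim (U \<inter> V)")
    case True
    then have "defect U V (f k) = 0"
      using defect_principal_vector[OF U V fe k] principal_angle_eq_0_iff[OF U V k] by simp
    then have "f k \<in> U \<inter> V" using defect_eq_0_iff[OF U V f(3)[OF k]] f(3)[OF k] by simp
    then have "orthogonal (v - orth_proj (U \<inter> V) v) (f k)" by (rule orth_proj_subspace(2)[OF UV])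
    then show ?thesis by (simp add: orthogonal_def w_def z_def)
  next
    case False
    then have "dim (U \<inter> V) < k" "k \<le> dim V" using k by auto
    note b = sin_principal_angle_bounds[OF U V this]
    show ?thesis using b by (intro disjI2 conjI power_mono) auto
  qed
  note b = sin_principal_angle_bounds[OF U V dim_Int_less[OF U V VU] order_refl]
  have "norm (line_min w (defect U V w)) \<le> crm_rate U V * norm w"
    unfolding crm_rate_def
  proof (rule kantorovich_line_min[OF f(1) _ _ _ coeff bounds])
    show "w \<in> span (f ` {1..dim V})" "defect U V w \<in> span (f ` {1..dim V})"
      unfolding f(2) by (rule wV, rule defect_in[OF V wV])
    show "0 < (sin (friedrichs_angle U V))\<^sup>2" using b(1) by simp
    show "(sin (friedrichs_angle U V))\<^sup>2 \<le> (sin (largest_angle U V))\<^sup>2"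
      using b by (intro power_mono) auto
  qed simp_all
  then show ?thesis
    using crm_op_residual[OF U V v z] by (simp add: w_def z_def)
qed

text \<open>The vectors with index \<open>dim (U \<inter> V) + 1\<close> and \<open>dim V\<close> are eigenvectors for the smallest nonzero and
  the largest eigenvalue of the defect. They lie in the range of the defect, hence are orthogonal to
  \<open>U \<inter> V\<close>, so \<open>z\<close> is the projection of \<open>v\<close>.\<close>

lemma crm_step_sharp:
  assumes U: "subspace U" and V: "subspace V" and VU: "\<not> V \<subseteq> U"
    and fe: "principal_frame U V f e" and z: "z \<in> U \<inter> V"
    and v: "v = z + sin (largest_angle U V) *\<^sub>R f (dim (U \<inter> V) + 1)
      + sin (friedrichs_angle U V) *\<^sub>R f (dim V)"
  shows "v \<in> V" and "v \<notin> U \<inter> V" and "orth_proj (U \<inter> V) v = z"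
    and "norm (crm_op U V v - z) = crm_rate U V * norm (v - z)"
proof -
  have UV: "subspace (U \<inter> V)" using U V by (rule subspace_inter)
  note f = principal_frameD[OF fe]
  have less: "dim (U \<inter> V) < dim V" by (rule dim_Int_less[OF U V VU])
  let ?F = "dim (U \<inter> V) + 1" and ?p = "dim V"
  define a where "a = sin (largest_angle U V)"
  define c where "c = sin (friedrichs_angle U V)"
  have F: "?F \<in> {1..dim V}" and p: "?p \<in> {1..dim V}" using less by auto
  have c0: "0 < c" and ca: "c \<le> a"
    using sin_principal_angle_bounds[OF U V less order_refl] by (auto simp: a_def c_def)
  define w where "w = a *\<^sub>R f ?F + c *\<^sub>R f ?p"
  have vz: "v = z + w" by (simp add: v w_def a_def c_def)
  have wV: "w \<in> V" unfolding w_def by (intro subspace_add[OF V] subspace_scale[OF V] f(3) F p)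
  show vV: "v \<in> V" unfolding vz using z wV by (intro subspace_add[OF V]) auto
  have dF: "defect U V (f ?F) = c\<^sup>2 *\<^sub>R f ?F" and dp: "defect U V (f ?p) = a\<^sup>2 *\<^sub>R f ?p"
    using defect_principal_vector[OF U V fe F] defect_principal_vector[OF U V fe p]
    by (simp_all add: a_def c_def friedrichs_angle_def largest_angle_def)
  have dw: "defect U V w = (a * c\<^sup>2) *\<^sub>R f ?F + (c * a\<^sup>2) *\<^sub>R f ?p"
    unfolding w_def linear_add[OF linear_defect[OF U V]] linear_cmul[OF linear_defect[OF U V]] dF dp
    by simp
  have on: "f ?F \<bullet> f ?p = (if ?F = ?p then 1 else 0)" "f ?F \<bullet> f ?F = 1"
    using f(1) F p unfolding orthonormal_family_def by simp_all
  have "0 < defect U V w \<bullet> f ?F"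
    using c0 ca on by (simp add: dw inner_add_left inner_commute[of "f ?p"] add_pos_pos)
  then have "defect U V w \<noteq> 0" by auto
  then have wU: "w \<notin> U" using defect_eq_0_iff[OF U V wV] by simp
  show "v \<notin> U \<inter> V"
  proof
    assume "v \<in> U \<inter> V"
    then have "v - z \<in> U" using z subspace_diff[OF U] by blast
    then show False using wU by (simp add: vz)
  qed
  show "orth_proj (U \<inter> V) v = z"
  proof (rule orth_proj_subspace_unique[OF UV z])
    fix y assume y: "y \<in> U \<inter> V"
    have "f ?F \<bullet> y = 0"
      using defect_orthogonal_Int[OF U V f(3)[OF F] y] c0 unfolding dF by simp
    moreover have "f ?p \<bullet> y = 0"
      using defect_orthogonal_Int[OF U V f(3)[OF p] y] c0 ca unfolding dp by simp
    ultimately show "orthogonal (v - z) y" by (simp add: vz w_def orthogonal_def inner_add_left)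
  qed
  have "f ?F \<bullet> f ?p = 0 \<or> f ?F = f ?p \<and> c\<^sup>2 = a\<^sup>2"
  proof (cases "?F = ?p")
    case True
    then have "c = a" by (simp add: a_def c_def friedrichs_angle_def largest_angle_def)
    then show ?thesis using True by simp
  qed (use on in simp)
  moreover have "0 < c\<^sup>2" "c\<^sup>2 \<le> a\<^sup>2" using c0 ca by (auto intro: power_mono)
  ultimately have "norm (line_min w (defect U V w)) = (a\<^sup>2 - c\<^sup>2) / (a\<^sup>2 + c\<^sup>2) * norm w"
    unfolding dw unfolding w_def using c0 ca
    by (intro kantorovich_line_min_sharp f(4) F p) auto
  then show "norm (crm_op U V v - z) = crm_rate U V * norm (v - z)"
    unfolding crm_op_residual[OF U V vV z] by (simp add: vz crm_rate_def a_def c_def)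
qed

text \<open>The difference of the two sides, multiplied by \<open>M + m\<close>, is \<open>m (2 - M - m)\<close>.\<close>

lemma kantorovich_rate_le:
  fixes m M :: real
  assumes "0 < m" "m \<le> M" "M \<le> 1"
  shows "(M - m) / (M + m) \<le> 1 - m" and "m < 1 \<Longrightarrow> (M - m) / (M + m) < 1 - m"
proof -
  have pos: "0 < M + m" using assms by simp
  have e: "(1 - m) * (M + m) - (M - m) = m * (2 - M - m)" by (simp add: algebra_simps)
  have "0 \<le> m * (2 - M - m)" using assms by (intro mult_nonneg_nonneg) auto
  then show "(M - m) / (M + m) \<le> 1 - m" unfolding pos_divide_le_eq[OF pos] using e by linarith
  assume "m < 1"
  then have "0 < m * (2 - M - m)" using assms by (intro mult_pos_pos) auto
  then show "(M - m) / (M + m) < 1 - m" unfolding pos_divide_less_eq[OF pos] using e by linarith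
qed

lemma crm_rate_le:
  assumes U: "subspace U" and V: "subspace V" and VU: "\<not> V \<subseteq> U"
  shows "crm_rate U V \<le> (cos (friedrichs_angle U V))\<^sup>2"
    and "friedrichs_angle U V < pi / 2 \<Longrightarrow> crm_rate U V < (cos (friedrichs_angle U V))\<^sup>2"
proof -
  let ?t = "friedrichs_angle U V"
  have less: "dim (U \<inter> V) < dim V" by (rule dim_Int_less[OF U V VU])
  note b = sin_principal_angle_bounds[OF U V less order_refl]
  have m: "0 < (sin ?t)\<^sup>2" "(sin ?t)\<^sup>2 \<le> (sin (largest_angle U V))\<^sup>2"
    using b by (auto intro: power_mono)
  have M: "(sin (largest_angle U V))\<^sup>2 \<le> 1" by (simp add: sin_squared_eq)
  show "crm_rate U V \<le> (cos ?t)\<^sup>2"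
    unfolding crm_rate_def cos_squared_eq by (rule kantorovich_rate_le(1)[OF m M])
  assume t: "?t < pi / 2"
  have "0 \<le> ?t"
    unfolding friedrichs_angle_def using less by (intro cos_principal_angle(2)[OF U V]) auto
  with t have "0 < cos ?t" using pi_gt_zero by (intro cos_gt_zero_pi) linarith+
  then have "(sin ?t)\<^sup>2 < 1" by (simp add: sin_squared_eq)
  then show "crm_rate U V < (cos ?t)\<^sup>2"
    unfolding crm_rate_def cos_squared_eq by (rule kantorovich_rate_le(2)[OF m M])
qed


section \<open>Convergence of the iteration\<close>

lemma crm_seq_invariants:
  assumes U: "subspace U" and V: "subspace V"
  shows "crm_seq U V x0 k \<in> V" and "orth_proj (U \<inter> V) (crm_seq U V x0 k) = orth_proj (U \<inter> V) x0"
proof (induction k)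
  case 0
  have UV: "subspace (U \<inter> V)" using U V by (rule subspace_inter)
  { case 1 show ?case by (simp add: orth_proj_subspace(1)[OF V]) }
  { case 2
    have "orth_proj (U \<inter> V) (orth_proj V x0) = orth_proj (U \<inter> V) x0"
    proof (rule orth_proj_subspace_unique[OF UV orth_proj_subspace(1)[OF UV]])
      fix z assume z: "z \<in> U \<inter> V"
      then have "(x0 - orth_proj V x0) \<bullet> z = 0" "(x0 - orth_proj (U \<inter> V) x0) \<bullet> z = 0"
        using orth_proj_subspace(2)[OF V, of z x0] orth_proj_subspace(2)[OF UV z, of x0]
        by (auto simp: orthogonal_def)
      then show "orthogonal (orth_proj V x0 - orth_proj (U \<inter> V) x0) z"
        by (simp add: orthogonal_def inner_diff_left)
    qed
    then show ?case by simp }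
next
  case (Suc k)
  { case 1 show ?case using crm_op_invariants(1)[OF U V Suc.IH(1)] by simp }
  { case 2 show ?case using crm_op_invariants(2)[OF U V Suc.IH(1)] Suc.IH(2) by simp }
qed

theorem theorem1p1:
  fixes U V :: "(real ^ 'n) set"
  assumes "subspace U" and "subspace V" and "\<not> V \<subseteq> U"
  shows
    "(\<forall>x0 k. crm_seq U V x0 k \<in> V \<and>
        orth_proj (U \<inter> V) (crm_seq U V x0 k) = orth_proj (U \<inter> V) x0 \<and>
        norm (crm_seq U V x0 (Suc k) - orth_proj (U \<inter> V) x0)
          \<le> crm_rate U V * norm (crm_seq U V x0 k - orth_proj (U \<inter> V) x0)) \<and>
     (\<exists>x0. orth_proj V x0 \<notin> U \<inter> V \<and>
        norm (crm_seq U V x0 1 - orth_proj (U \<inter> V) x0)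
          = crm_rate U V * norm (crm_seq U V x0 0 - orth_proj (U \<inter> V) x0)) \<and>
     (\<exists>f e. principal_frame U V f e) \<and>
     (\<forall>f e x0. principal_frame U V f e \<and>
        orth_proj V x0 = orth_proj (U \<inter> V) x0
          + sin (largest_angle U V) *\<^sub>R f (dim (U \<inter> V) + 1)
          + sin (friedrichs_angle U V) *\<^sub>R f (dim V) \<longrightarrow>
        orth_proj V x0 \<notin> U \<inter> V \<and>
        norm (crm_seq U V x0 1 - orth_proj (U \<inter> V) x0)
          = crm_rate U V * norm (crm_seq U V x0 0 - orth_proj (U \<inter> V) x0)) \<and>
     crm_rate U V \<le> (cos (friedrichs_angle U V))\<^sup>2 \<and>
     (friedrichs_angle U V < pi / 2 \<longrightarrow> crm_rate U V < (cos (friedrichs_angle U V))\<^sup>2)"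
proof (intro conjI allI impI)
  note U = assms(1) and V = assms(2) and VU = assms(3)
  have UV: "subspace (U \<inter> V)" using U V by (rule subspace_inter)
  show "crm_seq U V x0 k \<in> V" for x0 k by (rule crm_seq_invariants(1)[OF U V])
  show inv: "orth_proj (U \<inter> V) (crm_seq U V x0 k) = orth_proj (U \<inter> V) x0" for x0 k
    by (rule crm_seq_invariants(2)[OF U V])
  show "norm (crm_seq U V x0 (Suc k) - orth_proj (U \<inter> V) x0)
      \<le> crm_rate U V * norm (crm_seq U V x0 k - orth_proj (U \<inter> V) x0)" for x0 k
    using crm_step_contraction[OF U V VU crm_seq_invariants(1)[OF U V, of x0 k]] by (simp add: inv)
  show frame: "\<exists>f e. principal_frame U V f e" by (rule principal_frame_exists[OF U V])
  have sharp: "orth_proj V x0 \<notin> U \<inter> V"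
    "norm (crm_seq U V x0 1 - orth_proj (U \<inter> V) x0)
      = crm_rate U V * norm (crm_seq U V x0 0 - orth_proj (U \<inter> V) x0)"
    if "principal_frame U V f e \<and> orth_proj V x0 = orth_proj (U \<inter> V) x0
          + sin (largest_angle U V) *\<^sub>R f (dim (U \<inter> V) + 1)
          + sin (friedrichs_angle U V) *\<^sub>R f (dim V)" for f e x0
    using crm_step_sharp[OF U V VU conjunct1[OF that] orth_proj_subspace(1)[OF UV] conjunct2[OF that]]
    by simp_all
  then show "orth_proj V x0 \<notin> U \<inter> V"
    "norm (crm_seq U V x0 1 - orth_proj (U \<inter> V) x0)
      = crm_rate U V * norm (crm_seq U V x0 0 - orth_proj (U \<inter> V) x0)"
    if "principal_frame U V f e \<and> orth_proj V x0 = orth_proj (U \<inter> V) x0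
          + sin (largest_angle U V) *\<^sub>R f (dim (U \<inter> V) + 1)
          + sin (friedrichs_angle U V) *\<^sub>R f (dim V)" for f e x0
    using that by blast+
  show "\<exists>x0. orth_proj V x0 \<notin> U \<inter> V \<and>
      norm (crm_seq U V x0 1 - orth_proj (U \<inter> V) x0)
        = crm_rate U V * norm (crm_seq U V x0 0 - orth_proj (U \<inter> V) x0)"
  proof -
    obtain f e where fe: "principal_frame U V f e" using frame by blast
    define x where "x = 0 + sin (largest_angle U V) *\<^sub>R f (dim (U \<inter> V) + 1)
      + sin (friedrichs_angle U V) *\<^sub>R f (dim V)"
    have x: "x \<in> V" "orth_proj (U \<inter> V) x = 0"
      using crm_step_sharp(1,3)[OF U V VU fe subspace_0[OF UV] x_def] .
    have "orth_proj V x = orth_proj (U \<inter> V) x + sin (largest_angle U V) *\<^sub>R f (dim (U \<inter> V) + 1)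
      + sin (friedrichs_angle U V) *\<^sub>R f (dim V)"
      unfolding orth_proj_id[OF V x(1)] x(2) by (rule x_def)
    then show ?thesis using sharp[of f e x] fe by blast
  qed
  show "crm_rate U V \<le> (cos (friedrichs_angle U V))\<^sup>2" by (rule crm_rate_le(1)[OF U V VU])
  show "crm_rate U V < (cos (friedrichs_angle U V))\<^sup>2" if "friedrichs_angle U V < pi / 2"
    by (rule crm_rate_le(2)[OF U V VU that])
qed

end
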